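(* Let $L$ and $c$ be arbitrarily fixed positive numbers. Let $\sigma_0>2\pi^2/L^2$ and let $\eta_{2,0}=\eta_2(\sigma_0)$ be the unique number in the interval $(0,\sqrt{2c\sigma_0})$ such that $T_{\sigma_0}(\eta_{2,0})=L$. Then: (1) There are intervals $I(\sigma_0)$ and $B(\eta_{2,0})$ around $\sigma_0$ and $\eta_{2,0}$ respectively, and a unique smooth function $\Lambda:I(\sigma_0)\to B(\eta_{2,0})$, such that $\Lambda(\sigma_0)=\eta_{2,0}$ and $$\frac{4\sqrt c}{\sqrt{4c\sigma-\eta_2^2}}\,K(k(\sigma))=L,$$ where $\sigma\in I(\sigma_0)$, $\eta_2=\Lambda(\sigma)$, and $$k^2\equiv k^2(\sigma)=\frac{4c\sigma-2\eta_2^2}{4c\sigma-\eta_2^2}\in(0,1).$$ (2) The functions $$\phi_0(\xi)=\eta_1\,\mathrm{dn}\Big(\frac{\eta_1}{2\sqrt c}\xi;k\Big),\qquad \psi_0(\xi)=-\frac{\eta_1^2}{2c}\,\mathrm{dn}^2\Big(\frac{\eta_1}{2\sqrt c}\xi;k\Big),$$ determined by $\eta_2=\eta_2(\sigma)=\Lambda(\sigma)$, $\eta_1=\eta_1(\sigma)>0$ with $\eta_1^2+\eta_2^2=4c\sigma$, and $k=k(\sigma)$, have fundamental period $L$ and satisfy $$\phi_0''-\sigma\phi_0=\psi_0\phi_0,\qquad \psi_0=-\frac1{2c}\phi_0^2 .$$ Moreover, for every integer $n\ge1$ the mapping $\sigma\in I(\sigma_0)\mapsto\phi_0(\cdot;\eta_1(\sigma),\eta_2(\sigma))\in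 H^n_{per}([0,L])$ is smooth. (3) $I(\sigma_0)$ can be chosen as $\big(\frac{2\pi^2}{L^2},+\infty\big)$. (4) The mapping $\Lambda:I(\sigma_0)\to B(\eta_{2,0})$ is strictly decreasing. Therefore $\sigma\mapsto k(\sigma)$ is a strictly increasing function.
   Context: $K(k)=\int_0^1\frac{dt}{\sqrt{(1-t^2)(1-k^2t^2)}}$, $k\in(0,1)$, is the complete elliptic integral of the first kind; $\mathrm{dn}(\cdot;k)$ is the Jacobi elliptic function dnoidal of modulus $k$. For $\sigma>0$ and $\eta_2\in(0,\sqrt{2c\sigma})$ define $$T_\sigma(\eta_2)=\frac{4\sqrt c}{\sqrt{4c\sigma-\eta_2^2}}\,K(k(\eta_2)),\qquad k(\eta_2)>0,\quad k^2(\eta_2)=\frac{4c\sigma-2\eta_2^2}{4c\sigma-\eta_2^2}.$$ It is the fundamental period of the function $\phi_0$ built from $\eta_2$ (with $\eta_1=\sqrt{4c\sigma-\eta_2^2}$). $H^n_{per}([0,L])$ is the Sobolev space of $L$-periodic functions. *)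

theory Defs
  imports "HOL-Analysis.Analysis"
begin

definition ellip_K :: "real \<Rightarrow> real" where
  "ellip_K k = (LBINT t=0..1. 1 / sqrt ((1 - t\<^sup>2) * (1 - k\<^sup>2 * t\<^sup>2)))"

text \<open>The interval integral is oriented, so for \<open>0 < k < 1\<close> the incomplete integral
  \<open>ellip_F k\<close> is an increasing bijection of the real line. The amplitude
  \<open>jacobi_am k\<close> is its inverse.\<close>

definition ellip_F :: "real \<Rightarrow> real \<Rightarrow> real" where
  "ellip_F k \<phi> = (LBINT \<theta>=0..\<phi>. 1 / sqrt (1 - k\<^sup>2 * (sin \<theta>)\<^sup>2))"

definition jacobi_am :: "real \<Rightarrow> real \<Rightarrow> real" where
  "jacobi_am k u = (THE \<phi>. ellip_F k \<phi> = u)"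

definition jacobi_sn :: "real \<Rightarrow> real \<Rightarrow> real" where
  "jacobi_sn k u = sin (jacobi_am k u)"

definition jacobi_dn :: "real \<Rightarrow> real \<Rightarrow> real" where
  "jacobi_dn k u = sqrt (1 - k\<^sup>2 * (jacobi_sn k u)\<^sup>2)"


definition modulus_sq :: "real \<Rightarrow> real \<Rightarrow> real \<Rightarrow> real" where
  "modulus_sq c \<sigma> \<eta>2 = (4 * c * \<sigma> - 2 * \<eta>2\<^sup>2) / (4 * c * \<sigma> - \<eta>2\<^sup>2)"

definition modulus :: "real \<Rightarrow> real \<Rightarrow> real \<Rightarrow> real" where
  "modulus c \<sigma> \<eta>2 = sqrt (modulus_sq c \<sigma> \<eta>2)"

definition period_T :: "real \<Rightarrow> real \<Rightarrow> real \<Rightarrow> real" where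
  "period_T c \<sigma> \<eta>2 = 4 * sqrt c / sqrt (4 * c * \<sigma> - \<eta>2\<^sup>2) * ellip_K (modulus c \<sigma> \<eta>2)"

definition eta1 :: "real \<Rightarrow> real \<Rightarrow> real \<Rightarrow> real" where
  "eta1 c \<sigma> \<eta>2 = sqrt (4 * c * \<sigma> - \<eta>2\<^sup>2)"

definition phi0 :: "real \<Rightarrow> real \<Rightarrow> real \<Rightarrow> real \<Rightarrow> real" where
  "phi0 c \<sigma> \<eta>2 \<xi> =
     eta1 c \<sigma> \<eta>2 * jacobi_dn (modulus c \<sigma> \<eta>2) (eta1 c \<sigma> \<eta>2 / (2 * sqrt c) * \<xi>)"

definition psi0 :: "real \<Rightarrow> real \<Rightarrow> real \<Rightarrow> real \<Rightarrow> real" where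
  "psi0 c \<sigma> \<eta>2 \<xi> =
     - ((eta1 c \<sigma> \<eta>2)\<^sup>2 / (2 * c)) *
       (jacobi_dn (modulus c \<sigma> \<eta>2) (eta1 c \<sigma> \<eta>2 / (2 * sqrt c) * \<xi>))\<^sup>2"


definition fundamental_period :: "(real \<Rightarrow> 'a) \<Rightarrow> real \<Rightarrow> bool" where
  "fundamental_period f p \<longleftrightarrow>
     0 < p \<and> (\<forall>x. f (x + p) = f x) \<and> (\<forall>q. 0 < q \<and> q < p \<longrightarrow> (\<exists>x. f (x + q) \<noteq> f x))"

definition open_interval_around :: "real \<Rightarrow> real set \<Rightarrow> bool" where
  "open_interval_around x I \<longleftrightarrow> open I \<and> is_interval I \<and> x \<in> I"

text \<open>Infinitely often differentiable; meant for open \<open>I\<close>, where the iterated derivatives on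
  \<open>I\<close> do not depend on the values of \<open>f\<close> outside \<open>I\<close>.\<close>

definition smooth_on_open :: "real set \<Rightarrow> (real \<Rightarrow> real) \<Rightarrow> bool" where
  "smooth_on_open I f \<longleftrightarrow> (\<forall>j. \<forall>x\<in>I. ((deriv ^^ j) f) field_differentiable (at x))"

text \<open>A branch is a smooth solution \<open>\<eta>2 = \<Lambda> \<sigma>\<close> of \<open>period_T c \<sigma> \<eta>2 = L\<close> through
  \<open>(\<sigma>0, \<eta>0)\<close>. The condition on the squared modulus excludes junk values of \<open>sqrt\<close> and of
  division.\<close>

definition period_branch ::
    "real \<Rightarrow> real \<Rightarrow> real \<Rightarrow> real \<Rightarrow> real set \<Rightarrow> real set \<Rightarrow> (real \<Rightarrow> real) \<Rightarrow> bool" where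
  "period_branch L c \<sigma>0 \<eta>0 I B \<Lambda> \<longleftrightarrow>
     \<Lambda> ` I \<subseteq> B \<and> smooth_on_open I \<Lambda> \<and> \<Lambda> \<sigma>0 = \<eta>0 \<and>
     (\<forall>\<sigma>\<in>I. modulus_sq c \<sigma> (\<Lambda> \<sigma>) \<in> {0<..<1} \<and> period_T c \<sigma> (\<Lambda> \<sigma>) = L)"

text \<open>Uniqueness concerns functions on \<open>I\<close>; values outside \<open>I\<close> are irrelevant.\<close>

definition unique_period_branch ::
    "real \<Rightarrow> real \<Rightarrow> real \<Rightarrow> real \<Rightarrow> real set \<Rightarrow> real set \<Rightarrow> (real \<Rightarrow> real) \<Rightarrow> bool" where
  "unique_period_branch L c \<sigma>0 \<eta>0 I B \<Lambda> \<longleftrightarrow>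
     period_branch L c \<sigma>0 \<eta>0 I B \<Lambda> \<and>
     (\<forall>\<Lambda>'. period_branch L c \<sigma>0 \<eta>0 I B \<Lambda>' \<longrightarrow> (\<forall>\<sigma>\<in>I. \<Lambda>' \<sigma> = \<Lambda> \<sigma>))"


text \<open>Periodic Sobolev spaces of integer order \<open>n \<ge> 0\<close>, via Fourier coefficients. Elements are
  represented by functions, so \<open>Hper_norm\<close> vanishes on functions that are zero almost
  everywhere.\<close>

definition fourier_coeff :: "real \<Rightarrow> (real \<Rightarrow> complex) \<Rightarrow> int \<Rightarrow> complex" where
  "fourier_coeff L f m =
     (1 / L) *\<^sub>R (LINT x:{0..L}|lebesgue. f x * cis (- (2 * pi * real_of_int m * x / L)))"

definition Hper :: "nat \<Rightarrow> real \<Rightarrow> (real \<Rightarrow> complex) set" where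
  "Hper n L = {f. (\<forall>x. f (x + L) = f x) \<and> f \<in> borel_measurable lebesgue \<and>
     set_integrable lebesgue {0..L} (\<lambda>x. (norm (f x))\<^sup>2) \<and>
     (\<lambda>m::int. (1 + (real_of_int m)\<^sup>2) ^ n * (norm (fourier_coeff L f m))\<^sup>2) summable_on UNIV}"

definition Hper_norm :: "nat \<Rightarrow> real \<Rightarrow> (real \<Rightarrow> complex) \<Rightarrow> real" where
  "Hper_norm n L f =
     sqrt (L * (\<Sum>\<^sub>\<infinity>m::int. (1 + (real_of_int m)\<^sup>2) ^ n * (norm (fourier_coeff L f m))\<^sup>2))"

text \<open>A curve \<open>F\<close> on an open set \<open>I\<close> of parameters is smooth in \<open>Hper n L\<close> if it has derivatives
  \<open>D 0 = F, D 1, D 2, \<dots>\<close> of all orders, the difference quotients converging in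
  \<open>Hper_norm n L\<close>.\<close>

definition smooth_curve_Hper ::
    "nat \<Rightarrow> real \<Rightarrow> real set \<Rightarrow> (real \<Rightarrow> real \<Rightarrow> complex) \<Rightarrow> bool" where
  "smooth_curve_Hper n L I F \<longleftrightarrow>
     (\<exists>D :: nat \<Rightarrow> real \<Rightarrow> real \<Rightarrow> complex.
        (\<forall>\<sigma>\<in>I. D 0 \<sigma> = F \<sigma>) \<and>
        (\<forall>j. \<forall>\<sigma>\<in>I. D j \<sigma> \<in> Hper n L \<and>
           ((\<lambda>s. Hper_norm n L (\<lambda>x. (D j s x - D j \<sigma> x) /\<^sub>R (s - \<sigma>) - D (Suc j) \<sigma> x))
              \<longlongrightarrow> 0) (at \<sigma> within I)))"

end

theory Submission
  imports Defs
begin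

text \<open>Write \<open>p = k\<^sup>2\<close>. Since \<open>\<eta>\<^sub>2 = \<eta>\<^sub>1 sqrt (1 - p)\<close>, the equation \<open>T = L\<close> says that \<open>\<eta>\<^sub>1 = 4 sqrt c K / L\<close>, so its
  solutions form the curve \<open>\<sigma> = 4 (2 - p) K\<^sup>2 / L\<^sup>2\<close>, \<open>\<eta>\<^sub>2 = 4 sqrt c sqrt (1 - p) K / L\<close> for \<open>0 < p < 1\<close>.
  The first coordinate increases from \<open>2 \<pi>\<^sup>2 / L\<^sup>2\<close> to infinity with positive derivative and the second one
  decreases, so \<open>\<Lambda>\<close> is globally defined, unique and decreasing.

  For the smoothness of the waves no implicit function theorem in Sobolev spaces is needed. The quantities
  \<open>p\<close>, \<open>K\<close>, \<open>E\<close>, the rescaled amplitude and the incomplete integral of the second kind along it, all as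
  functions of \<open>(\<sigma>, x)\<close>, have partial derivatives which are elementary expressions in these same quantities.
  Hence all mixed partial derivatives of the wave exist and are continuous. Fourier coefficients decay by
  repeated integration by parts, so locally uniform convergence of difference quotients together with their
  \<open>x\<close>-derivatives gives convergence in every periodic Sobolev norm.\<close>

section \<open>Differentiation under the integral sign\<close>

text \<open>Solving the period equation in terms of \<open>p\<close> leaves one real function to
  invert, \<sigma> as a function of \<open>p\<close>. Its monotonicity is the delicate point, since
  \<open>K\<close> grows while \<open>2 - p\<close> shrinks. The sign of the derivative comes down
  to \<open>2 (1 - p) K < (2 - p) E\<close>, so the second complete integral enters although the
  theorem mentions only \<open>K\<close>.

  The parameter \<open>p = k^2\<close> is used instead of \<open>k\<close> because the integrals
  remain differentiable at \<open>p = 0\<close>. There \<open>K = pi / 2\<close>, which yields the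
  threshold \<open>2 pi^2 / L^2\<close> as a limit that is not attained. At the other end
  \<open>K\<close> has to be shown unbounded, and a logarithmic lower bound suffices.

  Uniqueness is likewise not a local matter: every solution with positive \<eta>2 and admissible
  modulus lies on the curve, so any branch is a restriction of a single explicit function, and the
  claims about arbitrary branches become claims about it.\<close>

lemma interval_integral_has_field_derivative:
  fixes f f' :: "real \<Rightarrow> real \<Rightarrow> real" and a b :: real
  assumes U: "open U" "convex U" "p \<in> U"
    and f': "\<And>p t. p \<in> U \<Longrightarrow> ((\<lambda>p. f p t) has_real_derivative f' p t) (at p)"
    and cont: "\<And>p. p \<in> U \<Longrightarrow> continuous_on UNIV (f p)"
    and cont': "continuous_on (U \<times> UNIV) (\<lambda>(p, t). f' p t)"
  shows "((\<lambda>p. LBINT t=a..b. f p t) has_real_derivative (LBINT t=a..b. f' p t)) (at p)"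
proof -
  have ordered: "((\<lambda>p. LBINT t=a..b. f p t) has_real_derivative (LBINT t=a..b. f' p t)) (at p)"
    if ab: "a \<le> b" for a b :: real
  proof -
    have eq: "(LBINT t=a..b. g t) = integral (cbox a b) g" if "continuous_on UNIV g" for g :: "real \<Rightarrow> real"
      using interval_integral_eq_integral[OF ab, of g] that continuous_on_subset
      by (metis borel_integrable_atLeastAtMost' cbox_interval subset_UNIV)
    have cont1: "continuous_on UNIV (f' p)" if "p \<in> U" for p
    proof -
      have "continuous_on UNIV (\<lambda>t. (\<lambda>(p, t). f' p t) (p, t))"
        by (rule continuous_on_compose2[OF cont']) (auto intro!: continuous_intros that)
      then show ?thesis by simp
    qed
    have "((\<lambda>p. integral (cbox a b) (f p)) has_real_derivative integral (cbox a b) (f' p)) (at p within U)"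
    proof (rule leibniz_rule_field_derivative)
      show "((\<lambda>x. f x t) has_real_derivative f' x t) (at x within U)" if "x \<in> U" for x t
        using f'[OF that] by (rule has_field_derivative_at_within)
      show "f x integrable_on cbox a b" if "x \<in> U" for x
        by (rule integrable_continuous, rule continuous_on_subset[OF cont[OF that]]) simp
      show "continuous_on (U \<times> cbox a b) (\<lambda>(x, t). f' x t)"
        by (rule continuous_on_subset[OF cont']) (rule Sigma_mono, simp_all)
    qed (use U in simp_all)
    then have "((\<lambda>p. integral (cbox a b) (f p)) has_real_derivative integral (cbox a b) (f' p)) (at p)"
      by (simp only: at_within_open[OF U(3,1)])
    then have "((\<lambda>p. LBINT t=a..b. f p t) has_real_derivative integral (cbox a b) (f' p)) (at p)"
      by (rule has_field_derivative_transform_within_open[OF _ U(1,3)]) (simp add: eq cont)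
    then show ?thesis
      using U by (simp add: eq cont1)
  qed
  show ?thesis
  \<comment> \<open>The upper limit will be an amplitude, which may be negative, so the oriented
    integral is needed for both orders of the endpoints.\<close>
  proof (cases "a \<le> b")
    case False
    then have "((\<lambda>p. - (LBINT t=b..a. f p t)) has_real_derivative - (LBINT t=b..a. f' p t)) (at p)"
      by (intro DERIV_minus ordered) auto
    then show ?thesis
      by (simp only: interval_integral_endpoints_reverse[of a b])
  qed (rule ordered)
qed

lemma interval_integral_has_field_derivative_endpoint:
  fixes f :: "real \<Rightarrow> real" and a x :: real
  assumes "continuous_on UNIV f"
  shows "((\<lambda>u. LBINT y=a..u. f y) has_real_derivative f x) (at x)"
proof -
  define l u where "l = min a x - 1" and "u = max a x + 1"
  have "((\<lambda>u. LBINT y=a..u. f y) has_vector_derivative f x) (at x within {l..u})"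
    by (rule interval_integral_FTC2) (use continuous_on_subset[OF assms] in \<open>auto simp: l_def u_def\<close>)
  moreover have "at x within {l..u} = at x"
    by (rule at_within_Icc_at) (auto simp: l_def u_def)
  ultimately show ?thesis
    by (simp add: has_real_derivative_iff_has_vector_derivative)
qed

lemma interval_integral_eq_antiderivative:
  fixes f F :: "real \<Rightarrow> real" and a b :: real
  assumes "continuous_on UNIV f" and "\<And>x. (F has_real_derivative f x) (at x)"
  shows "(LBINT x=a..b. f x) = F b - F a"
  by (rule interval_integral_FTC_finite)
    (use assms in \<open>auto simp: has_real_derivative_iff_has_vector_derivative
        intro: continuous_on_subset has_vector_derivative_at_within\<close>)

text \<open>A derivative in \<open>p\<close> at the one point together with a continuous
  \<phi>-derivative nearby gives total differentiability. For the elliptic integrals the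
  \<phi>-derivative is the integrand, whose joint continuity is immediate.\<close>

lemma has_derivative_joint:
  fixes f :: "real \<Rightarrow> real \<Rightarrow> real"
  assumes "open U" "p \<in> U"
    and "((\<lambda>p. f p \<phi>) has_real_derivative fp) (at p)"
    and "\<And>p \<phi>. p \<in> U \<Longrightarrow> (f p has_real_derivative fx p \<phi>) (at \<phi>)"
    and "continuous_on (U \<times> UNIV) (\<lambda>(p, \<phi>). fx p \<phi>)"
  shows "((\<lambda>(p, \<phi>). f p \<phi>) has_derivative (\<lambda>(dp, d\<phi>). fp * dp + fx p \<phi> * d\<phi>)) (at (p, \<phi>))"
proof -
  have "((\<lambda>(p, \<phi>). f p \<phi>) has_derivative (\<lambda>(dp, d\<phi>). fp * dp + blinfun_mult_right (fx p \<phi>) d\<phi>))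
      (at (p, \<phi>) within U \<times> UNIV)"
  proof (rule has_derivative_partialsI)
    show "((\<lambda>x. f x \<phi>) has_derivative (*) fp) (at p within U)"
      using assms(3) has_derivative_at_withinI unfolding has_field_derivative_def by blast
    show "(f x has_derivative blinfun_apply (blinfun_mult_right (fx x y))) (at y within UNIV)"
      if "x \<in> U" for x y
      using assms(4)[OF that, of y] by (simp add: has_field_derivative_def)
    have "continuous (at (p, \<phi>)) (\<lambda>(p, \<phi>). fx p \<phi>)"
      using assms(5,1,2) by (simp add: continuous_on_eq_continuous_at open_Times)
    then have "continuous (at (p, \<phi>)) (\<lambda>z. blinfun_mult_right (case z of (p, \<phi>) \<Rightarrow> fx p \<phi>))"
      by (rule bounded_linear.continuous[OF bounded_linear_blinfun_mult_right])
    then show "continuous (at (p, \<phi>) within U \<times> UNIV) (\<lambda>(x, y). blinfun_mult_right (fx x y))"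
      by (simp add: case_prod_unfold continuous_at_imp_continuous_at_within)
  qed auto
  moreover have "at (p, \<phi>) within U \<times> UNIV = at (p, \<phi>)"
    by (rule at_within_open) (use assms(1,2) in \<open>simp_all add: open_Times\<close>)
  ultimately show ?thesis
    by simp
qed

lemma DERIV_joint_chain:
  fixes f :: "real \<Rightarrow> real \<Rightarrow> real"
  assumes "((\<lambda>(p, u). f p u) has_derivative (\<lambda>(dp, du). A * dp + B * du)) (at (P s, U s))"
    and "(P has_real_derivative P') (at s)" "(U has_real_derivative U') (at s)"
  shows "((\<lambda>s. f (P s) (U s)) has_real_derivative A * P' + B * U') (at s)"
proof -
  have "((\<lambda>s. (P s, U s)) has_derivative (\<lambda>ds. (P' * ds, U' * ds))) (at s)"
    using assms(2,3) unfolding has_field_derivative_def by (rule has_derivative_Pair)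
  from has_derivative_compose[OF this assms(1)]
  have "((\<lambda>s. f (P s) (U s)) has_derivative (\<lambda>ds. A * (P' * ds) + B * (U' * ds))) (at s)"
    by simp
  moreover have "(\<lambda>ds. A * (P' * ds) + B * (U' * ds)) = (*) (A * P' + B * U')"
    by (simp add: fun_eq_iff algebra_simps)
  ultimately show ?thesis
    by (simp add: has_field_derivative_def)
qed

section \<open>Smooth functions of a parameter and a space variable\<close>

text \<open>The difference \<open>g r x - g r 0\<close> is the integral of \<open>gx r\<close>.
  Differentiating under the integral sign shows that \<open>gs s\<close> is, up to a constant, the
  integral of \<open>gxs s\<close>. Thus the existence of the \<open>x\<close>-derivative of
  \<open>gs\<close> is part of the conclusion.\<close>

lemma mixed_partials_commute:
  fixes g gs gx gxs :: "real \<Rightarrow> real \<Rightarrow> real"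
  assumes J: "open J" "s \<in> J"
    and g_x: "\<And>s x. s \<in> J \<Longrightarrow> (g s has_real_derivative gx s x) (at x)"
    and g_s: "\<And>s x. s \<in> J \<Longrightarrow> ((\<lambda>s. g s x) has_real_derivative gs s x) (at s)"
    and gx_s: "\<And>s x. s \<in> J \<Longrightarrow> ((\<lambda>s. gx s x) has_real_derivative gxs s x) (at s)"
    and cont: "continuous_on (J \<times> UNIV) (\<lambda>(s, x). gx s x)" "continuous_on (J \<times> UNIV) (\<lambda>(s, x). gxs s x)"
  shows "(gs s has_real_derivative gxs s x) (at x)"
proof -
  obtain e where e: "0 < e" "ball s e \<subseteq> J"
    using J open_contains_ball by blast
  have slice: "continuous_on UNIV (h r)" if "continuous_on (J \<times> UNIV) (\<lambda>(s, x). h s x)" "r \<in> J"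
    for h :: "real \<Rightarrow> real \<Rightarrow> real" and r
  proof -
    have "continuous_on UNIV (\<lambda>x. (\<lambda>(s, x). h s x) (r, x))"
      by (rule continuous_on_compose2[OF that(1)]) (auto intro!: continuous_intros that)
    then show ?thesis by simp
  qed
  have eq: "gs s = (\<lambda>x. gs s 0 + (LBINT t=ereal 0..x. gxs s t))"
  proof
    fix x
    have int: "(LBINT t=ereal 0..x. gx r t) = g r x - g r 0" if "r \<in> J" for r
      by (rule interval_integral_eq_antiderivative[OF slice[OF cont(1) that] g_x[OF that]])
    have "((\<lambda>r. LBINT t=ereal 0..x. gx r t) has_real_derivative (LBINT t=ereal 0..x. gxs s t)) (at s)"
    proof (rule interval_integral_has_field_derivative[where U="ball s e"])
      show "continuous_on (ball s e \<times> UNIV) (\<lambda>(p, t). gxs p t)"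
        by (rule continuous_on_subset[OF cont(2)]) (use e in auto)
    qed (use e in \<open>auto intro!: gx_s slice[OF cont(1)]\<close>)
    then have "((\<lambda>r. g r x - g r 0) has_real_derivative (LBINT t=ereal 0..x. gxs s t)) (at s)"
      by (rule has_field_derivative_transform_within_open[OF _ J]) (rule int)
    moreover have "((\<lambda>r. g r x - g r 0) has_real_derivative gs s x - gs s 0) (at s)"
      by (intro DERIV_diff g_s J)
    ultimately have "gs s x - gs s 0 = (LBINT t=ereal 0..x. gxs s t)"
      by (rule DERIV_unique[rotated])
    then show "gs s x = gs s 0 + (LBINT t=ereal 0..x. gxs s t)" by linarith
  qed
  have "((\<lambda>x. gs s 0 + (LBINT t=ereal 0..x. gxs s t)) has_real_derivative 0 + gxs s x) (at x)"
    by (intro DERIV_add DERIV_const interval_integral_has_field_derivative_endpoint slice[OF cont(2)] J)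
  then show ?thesis
    by (subst eq) simp
qed

text \<open>\<open>D i j\<close> is the partial derivative of \<open>D 0 0\<close> of order \<open>i\<close> in \<open>s\<close> and \<open>j\<close> in \<open>x\<close>.\<close>

definition smooth_family :: "real set \<Rightarrow> (nat \<Rightarrow> nat \<Rightarrow> real \<Rightarrow> real \<Rightarrow> real) \<Rightarrow> bool" where
  "smooth_family J D \<longleftrightarrow> (\<forall>i j. continuous_on (J \<times> UNIV) (\<lambda>(s, x). D i j s x) \<and>
     (\<forall>s\<in>J. \<forall>x. ((\<lambda>s. D i j s x) has_real_derivative D (Suc i) j s x) (at s) \<and>
                (D i j s has_real_derivative D i (Suc j) s x) (at x)))"

definition closed_under_partials :: "real set \<Rightarrow> (real \<Rightarrow> real \<Rightarrow> real) set \<Rightarrow> bool" where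
  "closed_under_partials J A \<longleftrightarrow> (\<forall>f\<in>A. continuous_on (J \<times> UNIV) (\<lambda>(s, x). f s x) \<and>
     (\<exists>g\<in>A. \<forall>s\<in>J. \<forall>x. ((\<lambda>s. f s x) has_real_derivative g s x) (at s)) \<and>
     (\<exists>g\<in>A. \<forall>s\<in>J. \<forall>x. (f s has_real_derivative g s x) (at x)))"

text \<open>Derivatives chosen inside \<open>A\<close> can be differentiated again without end. In
  the arrangement \<open>dx ^^ j\<close> after \<open>ds ^^ i\<close> the
  \<open>x\<close>-derivative is immediate, and the \<open>s\<close>-derivative requires carrying
  \<open>ds\<close> past \<open>dx ^^ j\<close>.\<close>

lemma closed_under_partials_smooth_family:
  assumes J: "open J" and A: "closed_under_partials J A" and f: "f \<in> A"
  shows "\<exists>D. smooth_family J D \<and> D 0 0 = f"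
proof -
  have "\<forall>f\<in>A. \<exists>g. g \<in> A \<and> (\<forall>s\<in>J. \<forall>x. ((\<lambda>s. f s x) has_real_derivative g s x) (at s))"
    using A unfolding closed_under_partials_def by blast
  then obtain ds where "\<forall>f\<in>A. ds f \<in> A \<and> (\<forall>s\<in>J. \<forall>x. ((\<lambda>s. f s x) has_real_derivative ds f s x) (at s))"
    by (rule bchoice[THEN exE])
  then have ds: "ds g \<in> A" "\<And>s x. s \<in> J \<Longrightarrow> ((\<lambda>s. g s x) has_real_derivative ds g s x) (at s)"
    if "g \<in> A" for g
    using that by blast+
  have "\<forall>f\<in>A. \<exists>g. g \<in> A \<and> (\<forall>s\<in>J. \<forall>x. (f s has_real_derivative g s x) (at x))"
    using A unfolding closed_under_partials_def by blast
  then obtain dx where "\<forall>f\<in>A. dx f \<in> A \<and> (\<forall>s\<in>J. \<forall>x. (f s has_real_derivative dx f s x) (at x))"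
    by (rule bchoice[THEN exE])
  then have dx: "dx g \<in> A" "\<And>s x. s \<in> J \<Longrightarrow> (g s has_real_derivative dx g s x) (at x)"
    if "g \<in> A" for g
    using that by blast+
  have cont: "continuous_on (J \<times> UNIV) (\<lambda>(s, x). g s x)" if "g \<in> A" for g
    using A that unfolding closed_under_partials_def by blast
  have dx_pow: "(dx ^^ j) g \<in> A" if "g \<in> A" for g j
    by (induction j) (use that dx in auto)
  have ds_pow: "(ds ^^ i) g \<in> A" if "g \<in> A" for g i
    by (induction i) (use that ds in auto)
  \<comment> \<open>The chosen derivatives are arbitrary off \<open>J\<close>, so \<open>ds\<close>
    and \<open>dx\<close> commute only on \<open>J\<close>. The claim is therefore about derivatives
    at points of \<open>J\<close> and not an equation between functions.\<close>
  have comm: "((\<lambda>s. (dx ^^ j) g s x) has_real_derivative (dx ^^ j) (ds g) s x) (at s)"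
    if "g \<in> A" "s \<in> J" for g j s x
    using that(2)
  proof (induction j arbitrary: s x)
    case 0
    then show ?case using ds(2)[OF that(1)] by simp
  next
    case (Suc j)
    define h where "h = (dx ^^ j) g"
    have h: "h \<in> A" "dx h \<in> A" "ds (dx h) \<in> A"
      using dx_pow[OF that(1)] dx ds by (auto simp: h_def)
    have "((dx ^^ j) (ds g) s has_real_derivative ds (dx h) s x) (at x)"
      by (rule mixed_partials_commute[OF J Suc.prems dx(2)[OF h(1)] _ ds(2)[OF h(2)] cont[OF h(2)] cont[OF h(3)]])
        (simp_all add: h_def Suc.IH)
    moreover have "((dx ^^ j) (ds g) s has_real_derivative dx ((dx ^^ j) (ds g)) s x) (at x)"
      by (rule dx(2)[OF dx_pow[OF ds(1)[OF that(1)]] Suc.prems])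
    ultimately have "ds (dx h) s x = (dx ^^ Suc j) (ds g) s x"
      using DERIV_unique by fastforce
    then show ?case
      using ds(2)[OF h(2) Suc.prems, of x] by (simp add: h_def)
  qed
  have "smooth_family J (\<lambda>i j. (dx ^^ j) ((ds ^^ i) f))"
    unfolding smooth_family_def
  proof (intro allI conjI ballI)
    fix i j
    show "continuous_on (J \<times> UNIV) (\<lambda>(s, x). (dx ^^ j) ((ds ^^ i) f) s x)"
      by (intro cont dx_pow ds_pow f)
    fix s x assume s: "s \<in> J"
    show "((\<lambda>s. (dx ^^ j) ((ds ^^ i) f) s x) has_real_derivative (dx ^^ j) ((ds ^^ Suc i) f) s x) (at s)"
      using comm[OF ds_pow[OF f] s] by simp
    show "((dx ^^ j) ((ds ^^ i) f) s has_real_derivative (dx ^^ Suc j) ((ds ^^ i) f) s x) (at x)"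
      using dx(2)[OF dx_pow[OF ds_pow[OF f]] s] by simp
  qed
  then show ?thesis by (intro exI[of _ "\<lambda>i j. (dx ^^ j) ((ds ^^ i) f)"]) simp
qed

section \<open>Elementary expressions in given generators\<close>

inductive_set elem_functions ::
    "real set \<Rightarrow> (real \<Rightarrow> real \<Rightarrow> real) set \<Rightarrow> (real \<Rightarrow> real \<Rightarrow> real) set"
  for J G where
  gen: "g \<in> G \<Longrightarrow> g \<in> elem_functions J G"
| const: "(\<lambda>s x. r) \<in> elem_functions J G"
| add: "f \<in> elem_functions J G \<Longrightarrow> g \<in> elem_functions J G \<Longrightarrow> (\<lambda>s x. f s x + g s x) \<in> elem_functions J G"
| mult: "f \<in> elem_functions J G \<Longrightarrow> g \<in> elem_functions J G \<Longrightarrow> (\<lambda>s x. f s x * g s x) \<in> elem_functions J G"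
| inverse: "f \<in> elem_functions J G \<Longrightarrow> (\<And>s x. s \<in> J \<Longrightarrow> f s x \<noteq> 0) \<Longrightarrow>
    (\<lambda>s x. inverse (f s x)) \<in> elem_functions J G"
| sqrt: "f \<in> elem_functions J G \<Longrightarrow> (\<And>s x. s \<in> J \<Longrightarrow> 0 < f s x) \<Longrightarrow>
    (\<lambda>s x. sqrt (f s x)) \<in> elem_functions J G"
| sin: "f \<in> elem_functions J G \<Longrightarrow> (\<lambda>s x. sin (f s x)) \<in> elem_functions J G"
| cos: "f \<in> elem_functions J G \<Longrightarrow> (\<lambda>s x. cos (f s x)) \<in> elem_functions J G"

lemma elem_functions_minus: "f \<in> elem_functions J G \<Longrightarrow> (\<lambda>s x. - f s x) \<in> elem_functions J G"
  using elem_functions.mult[OF elem_functions.const[of "-1"]] by fastforce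

lemma elem_functions_diff:
  "f \<in> elem_functions J G \<Longrightarrow> g \<in> elem_functions J G \<Longrightarrow> (\<lambda>s x. f s x - g s x) \<in> elem_functions J G"
  using elem_functions.add[OF _ elem_functions_minus] by fastforce

lemma elem_functions_divide:
  "f \<in> elem_functions J G \<Longrightarrow> g \<in> elem_functions J G \<Longrightarrow> (\<And>s x. s \<in> J \<Longrightarrow> g s x \<noteq> 0) \<Longrightarrow>
    (\<lambda>s x. f s x / g s x) \<in> elem_functions J G"
  unfolding divide_inverse by (intro elem_functions.mult elem_functions.inverse)

lemma elem_functions_power:
  "f \<in> elem_functions J G \<Longrightarrow> (\<lambda>s x. f s x ^ n) \<in> elem_functions J G"
  by (induction n) (auto intro: elem_functions.intros)

lemmas elem_functions_intros =
  elem_functions.const elem_functions.add elem_functions.mult elem_functions.sqrt elem_functions.sin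
  elem_functions.cos elem_functions_minus elem_functions_diff elem_functions_divide
  elem_functions_power

text \<open>The derivative of each operation is again built from these operations, so only the
  generators need checking. The derivative of a generator may involve all the others; the generators
  need to form a differential system that is closed only as a whole.\<close>

lemma elem_functions_closed_under_partials:
  assumes "\<And>g. g \<in> G \<Longrightarrow> continuous_on (J \<times> UNIV) (\<lambda>(s, x). g s x) \<and>
     (\<exists>h\<in>elem_functions J G. \<forall>s\<in>J. \<forall>x. ((\<lambda>s. g s x) has_real_derivative h s x) (at s)) \<and>
     (\<exists>h\<in>elem_functions J G. \<forall>s\<in>J. \<forall>x. (g s has_real_derivative h s x) (at x))"
  shows "closed_under_partials J (elem_functions J G)"
  unfolding closed_under_partials_def
proof
  let ?E = "elem_functions J G"
  \<comment> \<open>Membership is carried through the induction because derivatives of products and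
    compositions contain the functions themselves.\<close>
  define P where "P f \<longleftrightarrow> f \<in> ?E \<and> continuous_on (J \<times> UNIV) (\<lambda>(s, x). f s x) \<and>
     (\<exists>g\<in>?E. \<forall>s\<in>J. \<forall>x. ((\<lambda>s. f s x) has_real_derivative g s x) (at s)) \<and>
     (\<exists>g\<in>?E. \<forall>s\<in>J. \<forall>x. (f s has_real_derivative g s x) (at x))" for f
  have chain: "P (\<lambda>s x. \<phi> (f s x))"
    if f: "P f" and mem: "(\<lambda>s x. \<phi> (f s x)) \<in> ?E" "(\<lambda>s x. \<phi>' (f s x)) \<in> ?E"
      and d: "\<And>s x. s \<in> J \<Longrightarrow> (\<phi> has_real_derivative \<phi>' (f s x)) (at (f s x))"
    for f and \<phi> \<phi>' :: "real \<Rightarrow> real"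
  proof -
    obtain fs fx where fs: "fs \<in> ?E" "\<forall>s\<in>J. \<forall>x. ((\<lambda>s. f s x) has_real_derivative fs s x) (at s)"
      and fx: "fx \<in> ?E" "\<forall>s\<in>J. \<forall>x. (f s has_real_derivative fx s x) (at x)"
      and c: "continuous_on (J \<times> UNIV) (\<lambda>(s, x). f s x)"
      using f unfolding P_def by blast
    have "continuous_on ((\<lambda>(s, x). f s x) ` (J \<times> UNIV)) \<phi>"
      using d DERIV_isCont by (fastforce intro!: continuous_at_imp_continuous_on)
    then have "continuous_on (J \<times> UNIV) (\<lambda>z. \<phi> ((\<lambda>(s, x). f s x) z))"
      by (rule continuous_on_compose2[OF _ c]) simp
    moreover have "\<forall>s\<in>J. \<forall>x. ((\<lambda>s. \<phi> (f s x)) has_real_derivative \<phi>' (f s x) * fs s x) (at s)"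
    proof (intro ballI allI)
      fix s x assume "s \<in> J"
      then show "((\<lambda>s. \<phi> (f s x)) has_real_derivative \<phi>' (f s x) * fs s x) (at s)"
        by (intro DERIV_chain2[where f=\<phi> and g="\<lambda>s. f s x", OF d]) (use fs in auto)
    qed
    moreover have "\<forall>s\<in>J. \<forall>x. ((\<lambda>x. \<phi> (f s x)) has_real_derivative \<phi>' (f s x) * fx s x) (at x)"
    proof (intro ballI allI)
      fix s x assume "s \<in> J"
      then show "((\<lambda>x. \<phi> (f s x)) has_real_derivative \<phi>' (f s x) * fx s x) (at x)"
        by (intro DERIV_chain2[where f=\<phi> and g="f s", OF d]) (use fx in auto)
    qed
    ultimately show ?thesis
      using elem_functions.mult[OF mem(2) fs(1)] elem_functions.mult[OF mem(2) fx(1)] mem(1)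
      unfolding P_def by (fastforce simp: case_prod_unfold)
  qed
  have "P f" if "f \<in> ?E" for f
    using that
  proof induction
    case (gen g)
    then show ?case using assms[OF gen] elem_functions.gen by (auto simp: P_def)
  next
    case (const r)
    then show ?case
      unfolding P_def by (intro conjI bexI[of _ "\<lambda>s x. 0"]) (auto intro: elem_functions.const)
  next
    case (add f g)
    then obtain fs fx gs gx where
      "fs \<in> ?E" "\<forall>s\<in>J. \<forall>x. ((\<lambda>s. f s x) has_real_derivative fs s x) (at s)"
      "fx \<in> ?E" "\<forall>s\<in>J. \<forall>x. (f s has_real_derivative fx s x) (at x)"
      "gs \<in> ?E" "\<forall>s\<in>J. \<forall>x. ((\<lambda>s. g s x) has_real_derivative gs s x) (at s)"
      "gx \<in> ?E" "\<forall>s\<in>J. \<forall>x. (g s has_real_derivative gx s x) (at x)"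
      unfolding P_def by blast
    with add show ?case
      unfolding P_def
      by (intro conjI bexI[of _ "\<lambda>s x. fs s x + gs s x"] bexI[of _ "\<lambda>s x. fx s x + gx s x"])
        (auto intro!: elem_functions.add derivative_eq_intros continuous_intros simp: case_prod_unfold)
  next
    case (mult f g)
    then obtain fs fx gs gx where
      "fs \<in> ?E" "\<forall>s\<in>J. \<forall>x. ((\<lambda>s. f s x) has_real_derivative fs s x) (at s)"
      "fx \<in> ?E" "\<forall>s\<in>J. \<forall>x. (f s has_real_derivative fx s x) (at x)"
      "gs \<in> ?E" "\<forall>s\<in>J. \<forall>x. ((\<lambda>s. g s x) has_real_derivative gs s x) (at s)"
      "gx \<in> ?E" "\<forall>s\<in>J. \<forall>x. (g s has_real_derivative gx s x) (at x)"
      unfolding P_def by blast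
    with mult show ?case
      unfolding P_def
      by (intro conjI bexI[of _ "\<lambda>s x. fs s x * g s x + gs s x * f s x"]
            bexI[of _ "\<lambda>s x. fx s x * g s x + gx s x * f s x"])
        (auto intro!: elem_functions.add elem_functions.mult DERIV_mult continuous_intros simp: case_prod_unfold)
  next
    case (inverse f)
    then have E: "f \<in> ?E" by (simp add: P_def)
    have inv: "(\<lambda>s x. inverse (f s x)) \<in> ?E"
      using inverse E by (intro elem_functions.inverse)
    show ?case
    proof (rule chain[where f=f and \<phi>=inverse and \<phi>'="\<lambda>y. - (inverse y * inverse y)"])
      show "(\<lambda>s x. - (inverse (f s x) * inverse (f s x))) \<in> ?E"
        by (intro elem_functions_minus elem_functions.mult inv)
    qed (use inverse inv in \<open>auto intro!: derivative_eq_intros simp: power2_eq_square\<close>)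
  next
    case (sqrt f)
    then have E: "f \<in> ?E" by (simp add: P_def)
    have sq: "(\<lambda>s x. sqrt (f s x)) \<in> ?E"
      using sqrt E by (intro elem_functions.sqrt)
    show ?case
    proof (rule chain[where f=f and \<phi>=sqrt and \<phi>'="\<lambda>y. inverse (sqrt y) / 2"])
      show "(\<lambda>s x. inverse (sqrt (f s x)) / 2) \<in> ?E"
        using sqrt(2) by (intro elem_functions_divide elem_functions.inverse elem_functions.const sq)
          (auto simp: less_imp_neq[symmetric])
    qed (use sqrt sq in \<open>auto intro!: DERIV_real_sqrt\<close>)
  next
    case (sin f)
    then have E: "f \<in> ?E" by (simp add: P_def)
    show ?case
      by (rule chain[where f=f and \<phi>=sin and \<phi>'=cos]) (use sin E in \<open>auto intro: elem_functions.intros DERIV_sin\<close>)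
  next
    case (cos f)
    then have E: "f \<in> ?E" by (simp add: P_def)
    show ?case
      by (rule chain[where f=f and \<phi>=cos and \<phi>'="\<lambda>y. - sin y"])
        (use cos E in \<open>auto intro: elem_functions.intros elem_functions_minus DERIV_cos\<close>)
  qed
  then show "continuous_on (J \<times> UNIV) (\<lambda>(s, x). f s x) \<and>
     (\<exists>g\<in>?E. \<forall>s\<in>J. \<forall>x. ((\<lambda>s. f s x) has_real_derivative g s x) (at s)) \<and>
     (\<exists>g\<in>?E. \<forall>s\<in>J. \<forall>x. (f s has_real_derivative g s x) (at x))" if "f \<in> ?E" for f
    using that by (simp add: P_def)
qed

lemma smooth_family_smooth_on_open:
  assumes J: "open J" and D: "smooth_family J D"
  shows "smooth_on_open J (\<lambda>s. D 0 0 s x)"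
proof -
  have ds: "((\<lambda>s. D i 0 s x) has_real_derivative D (Suc i) 0 s x) (at s)" if "s \<in> J" for i s
    using D that unfolding smooth_family_def by blast
  have "\<forall>s\<in>J. (deriv ^^ j) (\<lambda>s. D 0 0 s x) s = D j 0 s x" for j
  proof (induction j)
    case (Suc j)
    show ?case
    proof
      fix s assume s: "s \<in> J"
      have "((deriv ^^ j) (\<lambda>s. D 0 0 s x) has_real_derivative D (Suc j) 0 s x) (at s)"
        by (rule has_field_derivative_transform_within_open[OF ds[OF s] J s]) (use Suc in auto)
      then show "(deriv ^^ Suc j) (\<lambda>s. D 0 0 s x) s = D (Suc j) 0 s x"
        by (simp add: DERIV_imp_deriv)
    qed
  qed simp
  then have "((deriv ^^ j) (\<lambda>s. D 0 0 s x) has_real_derivative D (Suc j) 0 s x) (at s)" if "s \<in> J" for j s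
    by (intro has_field_derivative_transform_within_open[OF ds[OF that] J that]) auto
  then show ?thesis
    unfolding smooth_on_open_def field_differentiable_def by blast
qed

lemma smooth_family_subset: "smooth_family J D \<Longrightarrow> I \<subseteq> J \<Longrightarrow> smooth_family I D"
  unfolding smooth_family_def by (blast intro: continuous_on_subset Sigma_mono)

section \<open>Periodic Sobolev norms\<close>

lemma fourier_coeff_eq_integral:
  assumes "continuous_on {0..L} f"
  shows "fourier_coeff L f m = (1 / L) *\<^sub>R integral {0..L} (\<lambda>x. f x * cis (- (2 * pi * real_of_int m * x / L)))"
proof -
  have "(\<lambda>x. f x * cis (- (2 * pi * real_of_int m * x / L))) absolutely_integrable_on {0..L}"
    unfolding divide_inverse by (intro absolutely_integrable_continuous_real continuous_intros assms)
  then show ?thesis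
    unfolding fourier_coeff_def by (simp add: set_lebesgue_integral_eq_integral)
qed

lemma norm_fourier_coeff_le:
  assumes "0 < L" "continuous_on {0..L} f" "\<And>x. x \<in> {0..L} \<Longrightarrow> norm (f x) \<le> B"
  shows "norm (fourier_coeff L f m) \<le> B"
proof -
  have "norm (integral {0..L} (\<lambda>x. f x * cis (- (2 * pi * real_of_int m * x / L)))) \<le> B * (L - 0)"
    by (rule integral_bound)
      (use assms in \<open>auto intro!: continuous_intros simp: norm_mult\<close>)
  then show ?thesis
    using assms(1) by (simp add: fourier_coeff_eq_integral[OF assms(2)] field_simps)
qed

lemma fourier_coeff_vector_derivative:
  assumes L: "0 < L" and per: "f L = f 0"
    and d: "\<And>x. (f has_vector_derivative f' x) (at x)" and c: "continuous_on UNIV f'"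
  shows "fourier_coeff L f' m = (2 * pi * \<i> * of_int m / L) * fourier_coeff L f m"
proof -
  define w where "w = 2 * pi * real_of_int m / L"
  define e where "e = (\<lambda>x. cis (- (w * x)))"
  have cf: "continuous_on {0..L} f" for L
    using has_vector_derivative_continuous[OF d] by (blast intro: continuous_at_imp_continuous_on)
  have ce: "continuous_on {0..L} e"
    unfolding e_def by (intro continuous_intros)
  have e: "(e has_vector_derivative - \<i> * w * e x) (at x)" for x
    unfolding e_def has_vector_derivative_def
    by (rule derivative_eq_intros refl)+ (auto simp: scaleR_conv_of_real algebra_simps)
  \<comment> \<open>This is integration by parts over one period: \<open>f\<close> and
    \<open>e\<close> take equal values at both ends, so the boundary term vanishes.\<close>
  have "((\<lambda>x. f x * (- \<i> * w * e x) + f' x * e x) has_integral f L * e L - f 0 * e 0) {0..L}"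
    using L by (intro fundamental_theorem_of_calculus
        has_vector_derivative_at_within[OF has_vector_derivative_mult[OF d e]]) simp
  moreover have "e L = 1"
  proof -
    have "e L = cis (2 * pi * (- real_of_int m))"
      using L by (simp add: e_def w_def)
    also have "\<dots> = 1" by (rule cis_multiple_2pi) simp
    finally show ?thesis .
  qed
  moreover have "e 0 = 1" by (simp add: e_def)
  ultimately have "integral {0..L} (\<lambda>x. f x * (- \<i> * w * e x) + f' x * e x) = 0"
    using per by (simp add: integral_unique)
  moreover have "integral {0..L} (\<lambda>x. f x * (- \<i> * w * e x) + f' x * e x)
      = integral {0..L} (\<lambda>x. (- \<i> * w) * (f x * e x)) + integral {0..L} (\<lambda>x. f' x * e x)"
    by (subst integral_add[symmetric])
      (auto intro!: integrable_continuous_interval continuous_intros cf ce continuous_on_subset[OF c]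
        simp: algebra_simps)
  moreover have "integral {0..L} (\<lambda>x. (- \<i> * w) * (f x * e x)) = (- \<i> * w) * integral {0..L} (\<lambda>x. f x * e x)"
    by (rule integral_mult_right)
  ultimately have int: "integral {0..L} (\<lambda>x. f' x * e x) = \<i> * w * integral {0..L} (\<lambda>x. f x * e x)"
    by (simp add: algebra_simps eq_neg_iff_add_eq_0)
  have four: "fourier_coeff L h m = (1 / L) *\<^sub>R integral {0..L} (\<lambda>x. h x * e x)" if "continuous_on {0..L} h" for h
    using fourier_coeff_eq_integral[OF that, of m] by (simp add: e_def w_def)
  show ?thesis
    using int by (simp add: four cf continuous_on_subset[OF c] w_def scaleR_conv_of_real)
qed

text \<open>For \<open>m \<noteq> 0\<close> the estimate \<open>1 + m^2 \<le> 2 m^2\<close> produces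
  the power of 2, and rewriting \<open>m\<close> as \<open>L / (2 pi)\<close> times the frequency
  \<open>2 pi m / L\<close> produces the power of \<open>L / (2 pi)\<close>. The summand 1 covers
  \<open>m = 0\<close>. The series is what remains of the weight after spending \<open>n + 1\<close>
  derivatives on a norm of order \<open>n\<close>.\<close>

definition Hper_const :: "nat \<Rightarrow> real \<Rightarrow> real" where
  "Hper_const n L = sqrt (L * (2 ^ Suc n * (1 + (L / (2 * pi)) ^ (2 * Suc n))
     * (\<Sum>\<^sub>\<infinity>m::int. 1 / (1 + (real_of_int m)\<^sup>2))))"

lemma summable_on_inverse_square_int: "(\<lambda>m::int. 1 / (1 + (real_of_int m)\<^sup>2)) summable_on UNIV"
proof -
  have "summable (\<lambda>n. 1 / (1 + (real n)\<^sup>2))"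
  proof (rule summable_comparison_test)
    show "summable (\<lambda>n. inverse (real n ^ 2))"
      by (rule inverse_power_summable) simp
    show "\<exists>N. \<forall>n\<ge>N. norm (1 / (1 + (real n)\<^sup>2)) \<le> inverse (real n ^ 2)"
      by (intro exI[of _ 1]) (auto simp: inverse_eq_divide intro!: divide_left_mono mult_pos_pos add_pos_nonneg)
  qed
  then have nat: "(\<lambda>n::nat. 1 / (1 + (real n)\<^sup>2)) summable_on UNIV"
    by (intro norm_summable_imp_summable_on) (simp add: abs_of_nonneg add_nonneg_nonneg)
  \<comment> \<open>Two copies of the natural numbers cover the integers; their overlap at 0 does no
    harm in a union.\<close>
  have "(\<lambda>m::int. 1 / (1 + (real_of_int m)\<^sup>2)) summable_on (range int \<union> range (\<lambda>n. - int n))"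
    by (intro summable_on_union; subst summable_on_reindex)
      (use nat in \<open>auto simp: o_def inj_on_def\<close>)
  moreover have "range int \<union> range (\<lambda>n. - int n) = (UNIV :: int set)"
    by (auto intro: int_cases2)
  ultimately show ?thesis by simp
qed

text \<open>Integrating by parts \<open>n + 1\<close> times makes the Fourier coefficients decay fast enough for the
  \<open>H\<^sup>n\<close> norm to be controlled by suprema.\<close>

lemma Hper_sup_bound:
  fixes F :: "nat \<Rightarrow> real \<Rightarrow> complex"
  assumes L: "0 < L" and per: "\<And>i x. F i (x + L) = F i x"
    and d: "\<And>i x. (F i has_vector_derivative F (Suc i) x) (at x)"
    and B: "\<And>x. x \<in> {0..L} \<Longrightarrow> norm (F 0 x) \<le> B" "\<And>x. x \<in> {0..L} \<Longrightarrow> norm (F (Suc n) x) \<le> B"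
  shows "F 0 \<in> Hper n L" "Hper_norm n L (F 0) \<le> Hper_const n L * B"
proof -
  have cont: "continuous_on A (F i)" for A i
    using d has_vector_derivative_continuous by (blast intro: continuous_at_imp_continuous_on)
  have B0: "0 \<le> B"
    using order_trans[OF norm_ge_zero B(1)[of 0]] L by simp
  define c where "c m = norm (fourier_coeff L (F 0) m)" for m
  have step: "fourier_coeff L (F (Suc i)) m = (2 * pi * \<i> * of_int m / L) * fourier_coeff L (F i) m" for i m
    by (rule fourier_coeff_vector_derivative) (use L per[of i 0] d cont in auto)
  have iter: "fourier_coeff L (F i) m = (2 * pi * \<i> * of_int m / L) ^ i * fourier_coeff L (F 0) m" for i m
    by (induction i) (simp_all add: step)
  have c0: "c m \<le> B" for m
    unfolding c_def by (rule norm_fourier_coeff_le[OF L cont B(1)])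
  have c1: "(2 * pi * \<bar>real_of_int m\<bar> / L) ^ Suc n * c m \<le> B" for m
  proof -
    have "norm (fourier_coeff L (F (Suc n)) m) \<le> B"
      by (rule norm_fourier_coeff_le[OF L cont B(2)])
    moreover have "norm (2 * pi * \<i> * of_int m / L) = 2 * pi * \<bar>real_of_int m\<bar> / L"
      using L by (simp add: norm_mult norm_divide)
    ultimately show ?thesis
      unfolding iter[of "Suc n"] norm_mult norm_power c_def by simp
  qed
  define q where "q = L / (2 * pi)"
  have q: "0 < q" using L by (simp add: q_def)
  define C where "C = 2 ^ Suc n * (1 + q ^ (2 * Suc n))"
  have main: "(1 + (real_of_int m)\<^sup>2) ^ n * (c m)\<^sup>2 \<le> C * B\<^sup>2 * (1 / (1 + (real_of_int m)\<^sup>2))" for m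
  proof -
    have "(1 + (real_of_int m)\<^sup>2) ^ Suc n * (c m)\<^sup>2 \<le> C * B\<^sup>2"
    proof (cases "m = 0")
      case True
      have "(c 0)\<^sup>2 \<le> 1 * B\<^sup>2"
        using c0[of 0] by (simp add: c_def power_mono)
      also have "\<dots> \<le> C * B\<^sup>2"
      proof (rule mult_right_mono)
        have "1 * 1 \<le> C"
          unfolding C_def using q by (intro mult_mono one_le_power) auto
        then show "1 \<le> C" by simp
      qed simp
      finally show ?thesis using True by simp
    next
      case False
      define r where "r = \<bar>real_of_int m\<bar>"
      have "1 \<le> r" using False by (simp add: r_def)
      then have "1\<^sup>2 \<le> r\<^sup>2" by (intro power_mono) auto
      then have "(1 + r\<^sup>2) ^ Suc n \<le> (2 * r\<^sup>2) ^ Suc n"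
        by (intro power_mono) auto
      then have "(1 + r\<^sup>2) ^ Suc n * (c m)\<^sup>2 \<le> (2 * r\<^sup>2) ^ Suc n * (c m)\<^sup>2"
        by (rule mult_right_mono) simp
      also have "\<dots> = 2 ^ Suc n * (r ^ Suc n * c m)\<^sup>2"
        by (simp only: power_mult_distrib power_mult[symmetric] mult_ac)
      also have "r ^ Suc n * c m = q ^ Suc n * ((2 * pi * r / L) ^ Suc n * c m)"
      proof -
        have "q * (2 * pi * r / L) = r" using L by (simp add: q_def)
        then have "q ^ Suc n * (2 * pi * r / L) ^ Suc n = r ^ Suc n"
          by (metis power_mult_distrib)
        then show ?thesis by (simp only: mult.assoc[symmetric])
      qed
      also have "(q ^ Suc n * ((2 * pi * r / L) ^ Suc n * c m))\<^sup>2 \<le> (q ^ Suc n * B)\<^sup>2"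
      proof (intro power_mono mult_left_mono)
        show "(2 * pi * r / L) ^ Suc n * c m \<le> B" using c1[of m] by (simp add: r_def)
        show "0 \<le> q ^ Suc n * ((2 * pi * r / L) ^ Suc n * c m)"
          using q L by (simp add: r_def c_def)
      qed (use q in simp)
      then have "2 ^ Suc n * (q ^ Suc n * ((2 * pi * r / L) ^ Suc n * c m))\<^sup>2 \<le> 2 ^ Suc n * (q ^ Suc n * B)\<^sup>2"
        by (rule mult_left_mono) simp
      also have "\<dots> = 2 ^ Suc n * q ^ (2 * Suc n) * B\<^sup>2"
        by (simp only: power_mult_distrib power_mult[symmetric] mult_ac)
      also have "\<dots> \<le> C * B\<^sup>2"
        unfolding C_def by (intro mult_right_mono mult_left_mono) auto
      finally show ?thesis by (simp add: r_def)
    qed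
    moreover have "0 < 1 + (real_of_int m)\<^sup>2"
      by (rule add_pos_nonneg) auto
    ultimately show ?thesis
      by (simp add: pos_le_divide_eq mult_ac)
  qed
  have sumC: "(\<lambda>m. C * B\<^sup>2 * (1 / (1 + (real_of_int m)\<^sup>2))) summable_on UNIV"
    by (rule summable_on_cmult_right[OF summable_on_inverse_square_int])
  have sum: "(\<lambda>m. (1 + (real_of_int m)\<^sup>2) ^ n * (c m)\<^sup>2) summable_on UNIV"
    by (rule summable_on_comparison_test[OF sumC main]) simp
  show "F 0 \<in> Hper n L"
    unfolding Hper_def mem_Collect_eq
  proof (intro conjI allI)
    show "F 0 (x + L) = F 0 x" for x by (rule per)
    show "F 0 \<in> borel_measurable lebesgue"
      using borel_measurable_continuous_onI[OF cont[of UNIV 0]] by (simp add: measurable_completion)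
    show "set_integrable lebesgue {0..L} (\<lambda>x. (norm (F 0 x))\<^sup>2)"
      by (intro absolutely_integrable_continuous_real continuous_intros cont)
    show "(\<lambda>m. (1 + (real_of_int m)\<^sup>2) ^ n * (norm (fourier_coeff L (F 0) m))\<^sup>2) summable_on UNIV"
      using sum by (simp add: c_def)
  qed
  have "(\<Sum>\<^sub>\<infinity>m. (1 + (real_of_int m)\<^sup>2) ^ n * (c m)\<^sup>2) \<le> (\<Sum>\<^sub>\<infinity>m. C * B\<^sup>2 * (1 / (1 + (real_of_int m)\<^sup>2)))"
    by (rule infsum_mono[OF sum sumC main])
  also have "\<dots> = C * B\<^sup>2 * (\<Sum>\<^sub>\<infinity>m::int. 1 / (1 + (real_of_int m)\<^sup>2))"
    by (rule infsum_cmult_right) (rule summable_on_inverse_square_int)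
  finally have "L * (\<Sum>\<^sub>\<infinity>m. (1 + (real_of_int m)\<^sup>2) ^ n * (c m)\<^sup>2)
      \<le> L * (C * (\<Sum>\<^sub>\<infinity>m::int. 1 / (1 + (real_of_int m)\<^sup>2))) * B\<^sup>2"
    using L by (simp add: mult_ac)
  then have "sqrt (L * (\<Sum>\<^sub>\<infinity>m. (1 + (real_of_int m)\<^sup>2) ^ n * (c m)\<^sup>2))
      \<le> sqrt (L * (C * (\<Sum>\<^sub>\<infinity>m::int. 1 / (1 + (real_of_int m)\<^sup>2)))) * B"
    using B0 real_sqrt_le_mono by (fastforce simp: real_sqrt_mult)
  then show "Hper_norm n L (F 0) \<le> Hper_const n L * B"
    unfolding Hper_norm_def Hper_const_def c_def C_def q_def .
qed

text \<open>Subtracting the linear function \<open>s * h' r x\<close> leaves a function of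
  \<open>s\<close> with derivative \<open>h' s x - h' r x\<close>. Uniform continuity on a compact
  rectangle makes this small for all \<open>x\<close> at once, and the mean value inequality
  transfers the bound to the quotient.\<close>

lemma difference_quotient_uniform:
  fixes h h' :: "real \<Rightarrow> real \<Rightarrow> real"
  assumes I: "open I" "r \<in> I"
    and d: "\<And>s x. s \<in> I \<Longrightarrow> ((\<lambda>s. h s x) has_real_derivative h' s x) (at s)"
    and c: "continuous_on (I \<times> UNIV) (\<lambda>(s, x). h' s x)" and e: "0 < e"
  shows "\<forall>\<^sub>F s in at r. \<forall>x\<in>{0..L}. \<bar>(h s x - h r x) / (s - r) - h' r x\<bar> \<le> e"
proof -
  obtain \<rho> where \<rho>: "0 < \<rho>" "cball r \<rho> \<subseteq> I"
    using I open_contains_cball by blast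
  have "uniformly_continuous_on (cball r \<rho> \<times> {0..L}) (\<lambda>(s, x). h' s x)"
    by (intro compact_uniformly_continuous continuous_on_subset[OF c] compact_Times) (use \<rho> in auto)
  then obtain \<delta> where \<delta>: "0 < \<delta>" and
    uc: "\<And>z z'. z \<in> cball r \<rho> \<times> {0..L} \<Longrightarrow> z' \<in> cball r \<rho> \<times> {0..L} \<Longrightarrow> dist z' z < \<delta> \<Longrightarrow>
      dist (case z' of (s, x) \<Rightarrow> h' s x) (case z of (s, x) \<Rightarrow> h' s x) < e"
    using e unfolding uniformly_continuous_on_def by metis
  have "\<bar>(h s x - h r x) / (s - r) - h' r x\<bar> \<le> e"
    if s: "s \<noteq> r" "dist s r < min \<rho> \<delta>" and x: "x \<in> {0..L}" for s x
  proof -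
    let ?S = "ball r (min \<rho> \<delta>)"
    have "norm ((h s x - s * h' r x) - (h r x - r * h' r x)) \<le> e * norm (s - r)"
    proof (rule field_differentiable_bound[where S="?S" and f="\<lambda>s. h s x - s * h' r x"])
      fix z assume z: "z \<in> ?S"
      then have "z \<in> I" using \<rho> by auto
      then show "((\<lambda>s. h s x - s * h' r x) has_real_derivative h' z x - h' r x) (at z within ?S)"
        by (intro DERIV_diff has_field_derivative_at_within[OF d] DERIV_cmult_right[OF DERIV_ident, THEN DERIV_cong]) auto
      have "dist (z, x) (r, x) < \<delta>" using z by (simp add: dist_Pair_Pair dist_commute)
      then show "norm (h' z x - h' r x) \<le> e"
        using uc[of "(r, x)" "(z, x)"] z x \<rho> by (auto simp: dist_norm)
    qed (use s \<rho> \<delta> in \<open>auto simp: dist_commute\<close>)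
    then have "\<bar>(h s x - h r x) - (s - r) * h' r x\<bar> \<le> e * \<bar>s - r\<bar>"
      by (simp add: algebra_simps)
    moreover have "(h s x - h r x) / (s - r) - h' r x = ((h s x - h r x) - (s - r) * h' r x) / (s - r)"
      using s by (simp add: field_simps)
    ultimately show ?thesis
      using s by (simp add: pos_divide_le_eq)
  qed
  then show ?thesis
    unfolding eventually_at using \<rho> \<delta> by (intro exI[of _ "min \<rho> \<delta>"]) auto
qed

text \<open>The error of a difference quotient in \<open>s\<close> is itself smooth and periodic in
  \<open>x\<close>, and its \<open>x\<close>-derivatives are the errors belonging to
  \<open>D i j\<close>. So \<open>Hper_sup_bound\<close> applies to it, and only the errors of
  orders 0 and \<open>n + 1\<close> in \<open>x\<close> must be uniformly small.\<close>

lemma smooth_family_smooth_curve_Hper: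
  assumes L: "0 < L" and I: "open I" and D: "smooth_family I D"
    and per: "\<And>s x. s \<in> I \<Longrightarrow> D 0 0 s (x + L) = D 0 0 s x"
  shows "smooth_curve_Hper n L I (\<lambda>s x. complex_of_real (D 0 0 s x))"
proof -
  have cont: "continuous_on (I \<times> UNIV) (\<lambda>(s, x). D i j s x)"
    and ds: "\<And>s x. s \<in> I \<Longrightarrow> ((\<lambda>s. D i j s x) has_real_derivative D (Suc i) j s x) (at s)"
    and dx: "\<And>s x. s \<in> I \<Longrightarrow> (D i j s has_real_derivative D i (Suc j) s x) (at x)" for i j
    using D unfolding smooth_family_def by blast+
  \<comment> \<open>Periodicity is assumed for \<open>D 0 0\<close> only. It passes to every
    derivative, first in \<open>s\<close> and then in \<open>x\<close>, by uniqueness of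
    derivatives.\<close>
  have per_s: "D i 0 s (x + L) = D i 0 s x" if "s \<in> I" for i s x
    using that
  proof (induction i arbitrary: s)
    case (Suc i)
    have "((\<lambda>s. D i 0 s (x + L)) has_real_derivative D (Suc i) 0 s x) (at s)"
      by (rule has_field_derivative_transform_within_open[OF ds[OF Suc.prems] I Suc.prems])
        (simp add: Suc.IH)
    from DERIV_unique[OF ds[OF Suc.prems] this] show ?case .
  qed (rule per)
  have per: "D i j s (x + L) = D i j s x" if s: "s \<in> I" for i j s x
  proof (induction j arbitrary: x)
    case (Suc j)
    have "((\<lambda>x. D i j s (x + L)) has_real_derivative D i (Suc j) s (x + L)) (at x)"
      using DERIV_shift dx[OF s] by blast
    then have "(D i j s has_real_derivative D i (Suc j) s (x + L)) (at x)"
      by (simp add: Suc)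
    from DERIV_unique[OF this dx[OF s]] show ?case .
  qed (simp add: per_s s)
  have contx: "continuous_on A (D i j s)" if "s \<in> I" for A i j s
    using dx[OF that] DERIV_isCont by (blast intro: continuous_at_imp_continuous_on)
  have mem: "(\<lambda>x. complex_of_real (D i 0 s x)) \<in> Hper n L" if s: "s \<in> I" for i s
  proof -
    define B where "B j = (SOME B. \<forall>x\<in>{0..L}. norm (D i j s x) \<le> B)" for j
    have "\<exists>B. \<forall>x\<in>{0..L}. norm (D i j s x) \<le> B" for j
      using compact_imp_bounded[OF compact_continuous_image[OF contx[OF s] compact_Icc]]
      unfolding bounded_iff by blast
    then have B: "\<forall>x\<in>{0..L}. norm (D i j s x) \<le> B j" for j
      unfolding B_def by (rule someI_ex)
    show ?thesis
    proof (rule Hper_sup_bound(1)[where F="\<lambda>j x. complex_of_real (D i j s x)" and B="max (B 0) (B (Suc n))"])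
      show "((\<lambda>x. complex_of_real (D i j s x)) has_vector_derivative complex_of_real (D i (Suc j) s x)) (at x)" for j x
        by (intro has_vector_derivative_of_real dx s)
    qed (use B L in \<open>auto simp: per s le_max_iff_disj\<close>)
  qed
  have lim: "((\<lambda>s. Hper_norm n L (\<lambda>x. (complex_of_real (D i 0 s x) - complex_of_real (D i 0 r x)) /\<^sub>R (s - r)
      - complex_of_real (D (Suc i) 0 r x))) \<longlongrightarrow> 0) (at r within I)" if r: "r \<in> I" for i r
  proof (rule tendstoI)
    fix e :: real assume e: "0 < e"
    define K where "K = Hper_const n L"
    have K: "0 \<le> K"
      unfolding K_def Hper_const_def using L by (intro real_sqrt_ge_zero mult_nonneg_nonneg infsum_nonneg) auto
    \<comment> \<open>Adding 1 keeps the quotient meaningful for \<open>K = 0\<close> and makes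
      \<open>K * \<epsilon> < e\<close> strict.\<close>
    define \<epsilon> where "\<epsilon> = e / (K + 1)"
    have \<epsilon>: "0 < \<epsilon>" "K * \<epsilon> < e"
      using e K by (auto simp: \<epsilon>_def field_simps)
    have "\<forall>\<^sub>F s in at r. s \<in> I"
      using I r by (rule eventually_at_in_open')
    moreover have "\<forall>\<^sub>F s in at r. \<forall>x\<in>{0..L}. \<bar>(D i j s x - D i j r x) / (s - r) - D (Suc i) j r x\<bar> \<le> \<epsilon>" for j
      by (rule difference_quotient_uniform[OF I r ds cont \<epsilon>(1)])
    ultimately have "\<forall>\<^sub>F s in at r. s \<in> I
       \<and> (\<forall>x\<in>{0..L}. \<bar>(D i 0 s x - D i 0 r x) / (s - r) - D (Suc i) 0 r x\<bar> \<le> \<epsilon>)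
       \<and> (\<forall>x\<in>{0..L}. \<bar>(D i (Suc n) s x - D i (Suc n) r x) / (s - r) - D (Suc i) (Suc n) r x\<bar> \<le> \<epsilon>)"
      by (intro eventually_conj)
    then have "\<forall>\<^sub>F s in at r. dist (Hper_norm n L (\<lambda>x. (complex_of_real (D i 0 s x) - complex_of_real (D i 0 r x)) /\<^sub>R (s - r)
      - complex_of_real (D (Suc i) 0 r x))) 0 < e"
    proof eventually_elim
      case (elim s)
      define F where "F j x = complex_of_real ((D i j s x - D i j r x) / (s - r) - D (Suc i) j r x)" for j x
      have "Hper_norm n L (F 0) \<le> K * \<epsilon>"
        unfolding K_def
      proof (rule Hper_sup_bound(2)[where F=F])
        show "(F j has_vector_derivative F (Suc j) x) (at x)" for j x
          unfolding F_def using elim r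
          by (intro has_vector_derivative_of_real DERIV_diff DERIV_cdivide dx) auto
        show "norm (F 0 x) \<le> \<epsilon>" "norm (F (Suc n) x) \<le> \<epsilon>" if "x \<in> {0..L}" for x
          using elim that unfolding F_def norm_of_real by blast+
      qed (use elim r L in \<open>auto simp: F_def per\<close>)
      moreover have "F 0 = (\<lambda>x. (complex_of_real (D i 0 s x) - complex_of_real (D i 0 r x)) /\<^sub>R (s - r)
          - complex_of_real (D (Suc i) 0 r x))"
        by (simp add: F_def fun_eq_iff scaleR_conv_of_real divide_inverse mult.commute)
      moreover have "0 \<le> Hper_norm n L (F 0)"
        unfolding Hper_norm_def using L by (intro real_sqrt_ge_zero mult_nonneg_nonneg infsum_nonneg) auto
      ultimately show ?case
        using \<epsilon>(2) by simp
    qed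
    then show "\<forall>\<^sub>F s in at r within I. dist (Hper_norm n L (\<lambda>x. (complex_of_real (D i 0 s x) - complex_of_real (D i 0 r x)) /\<^sub>R (s - r)
      - complex_of_real (D (Suc i) 0 r x))) 0 < e"
      by (rule filter_leD[OF at_le[OF subset_UNIV]])
  qed
  show ?thesis
    unfolding smooth_curve_Hper_def
    by (intro exI[of _ "\<lambda>i s x. complex_of_real (D i 0 s x)"] conjI allI ballI mem lim) auto
qed

section \<open>Elliptic integrals and the amplitude\<close>

text \<open>Here \<open>p\<close> is the parameter \<open>k\<^sup>2\<close>, not the modulus \<open>k\<close>.\<close>

definition ell_delta :: "real \<Rightarrow> real \<Rightarrow> real" where
  "ell_delta p \<theta> = sqrt (1 - p * (sin \<theta>)\<^sup>2)"

definition ell_F :: "real \<Rightarrow> real \<Rightarrow> real" where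
  "ell_F p \<phi> = (LBINT \<theta>=0..\<phi>. 1 / ell_delta p \<theta>)"

definition ell_E :: "real \<Rightarrow> real \<Rightarrow> real" where
  "ell_E p \<phi> = (LBINT \<theta>=0..\<phi>. ell_delta p \<theta>)"

lemma delta_sq_pos: "p < 1 \<Longrightarrow> 0 < 1 - p * (sin \<theta>)\<^sup>2" for p \<theta> :: real
proof -
  assume "p < 1"
  have s: "0 \<le> (sin \<theta>)\<^sup>2" "(sin \<theta>)\<^sup>2 \<le> 1"
    by (auto simp: abs_square_le_1)
  show ?thesis
  proof (cases "p \<le> 0")
    case True
    then show ?thesis using s(1) mult_nonpos_nonneg[of p "(sin \<theta>)\<^sup>2"] by linarith
  next
    case False
    then have "p * (sin \<theta>)\<^sup>2 \<le> p * 1"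
      using s by (intro mult_left_mono) auto
    then show ?thesis using \<open>p < 1\<close> by linarith
  qed
qed

lemma ell_delta_pos: "p < 1 \<Longrightarrow> 0 < ell_delta p \<theta>"
  using delta_sq_pos by (simp add: ell_delta_def)

lemma ell_delta_sq: "p < 1 \<Longrightarrow> (ell_delta p \<theta>)\<^sup>2 = 1 - p * (sin \<theta>)\<^sup>2"
  using delta_sq_pos[of p \<theta>] by (simp add: ell_delta_def)

lemma continuous_on_ell_delta [continuous_intros]:
  fixes f g :: "'a::t2_space \<Rightarrow> real"
  shows "continuous_on A f \<Longrightarrow> continuous_on A g \<Longrightarrow> continuous_on A (\<lambda>x. ell_delta (f x) (g x))"
  unfolding ell_delta_def by (intro continuous_intros)

lemma DERIV_ell_delta_phi:
  assumes "p < 1"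
  shows "(ell_delta p has_real_derivative - p * sin \<theta> * cos \<theta> / ell_delta p \<theta>) (at \<theta>)"
  unfolding ell_delta_def
  using delta_sq_pos[OF assms, of \<theta>]
  by (auto intro!: derivative_eq_intros simp: field_simps)

lemma DERIV_ell_delta_p:
  assumes "p < 1"
  shows "((\<lambda>p. ell_delta p \<theta>) has_real_derivative - ((sin \<theta>)\<^sup>2 / (2 * ell_delta p \<theta>))) (at p)"
  unfolding ell_delta_def
  using delta_sq_pos[OF assms, of \<theta>]
  by (auto intro!: derivative_eq_intros simp: field_simps)

lemma DERIV_ell_F_phi:
  assumes "p < 1"
  shows "(ell_F p has_real_derivative 1 / ell_delta p \<phi>) (at \<phi>)"
proof -
  have "continuous_on UNIV (\<lambda>\<theta>. 1 / ell_delta p \<theta>)"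
    using ell_delta_pos[OF assms] by (intro continuous_intros) (metis less_irrefl)
  from interval_integral_has_field_derivative_endpoint[OF this, of 0 \<phi>] show ?thesis
    unfolding ell_F_def[abs_def] by (simp add: zero_ereal_def)
qed

lemma DERIV_ell_E_phi:
  shows "(ell_E p has_real_derivative ell_delta p \<phi>) (at \<phi>)"
proof -
  have "continuous_on UNIV (\<lambda>\<theta>. ell_delta p \<theta>)"
    by (intro continuous_intros)
  from interval_integral_has_field_derivative_endpoint[OF this, of 0 \<phi>] show ?thesis
    unfolding ell_E_def[abs_def] by (simp add: zero_ereal_def)
qed

lemma ell_F_0 [simp]: "ell_F p 0 = 0" and ell_E_0 [simp]: "ell_E p 0 = 0"
  by (simp_all add: ell_F_def ell_E_def zero_ereal_def)

text \<open>The closed form of the partial derivative of \<open>ell_F\<close> in \<open>p\<close>.\<close>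

definition ell_Fp :: "real \<Rightarrow> real \<Rightarrow> real" where
  "ell_Fp p \<phi> = (ell_E p \<phi> - (1 - p) * ell_F p \<phi>) / (2 * p * (1 - p))
     - sin \<phi> * cos \<phi> / (2 * (1 - p) * ell_delta p \<phi>)"

text \<open>The integral form of the derivative holds also at \<open>p = 0\<close>, where the closed
  form divides by zero. It supplies the continuity at the endpoint from which the solution curve
  starts.\<close>

lemma DERIV_ell_E_p_integral:
  assumes "p < 1"
  shows "((\<lambda>p. ell_E p \<phi>) has_real_derivative
      (LBINT \<theta>=ereal 0..\<phi>. - ((sin \<theta>)\<^sup>2 / (2 * ell_delta p \<theta>)))) (at p)"
proof -
  have nz: "ell_delta p \<theta> \<noteq> 0" if "p < 1" for p \<theta>
    using ell_delta_pos[OF that, of \<theta>] by simp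
  have "((\<lambda>p. LBINT \<theta>=ereal 0..\<phi>. ell_delta p \<theta>) has_real_derivative
      (LBINT \<theta>=ereal 0..\<phi>. - ((sin \<theta>)\<^sup>2 / (2 * ell_delta p \<theta>)))) (at p)"
    by (rule interval_integral_has_field_derivative[where U="{..<1}"])
      (use assms in \<open>auto intro!: continuous_intros DERIV_ell_delta_p simp: case_prod_unfold nz\<close>)
  then show ?thesis
    by (simp add: ell_E_def[abs_def] zero_ereal_def)
qed

text \<open>With \<open>d = ell_delta p \<theta>\<close> one has
  \<open>sin^2 \<theta> = (1 - d^2) / p\<close>, so the differentiated integrand is
  \<open>(d - 1 / d) / (2 p)\<close>, a combination of the integrands of \<open>ell_E\<close> and
  \<open>ell_F\<close>.\<close>

lemma DERIV_ell_E_p: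
  assumes "p < 1" "p \<noteq> 0"
  shows "((\<lambda>p. ell_E p \<phi>) has_real_derivative (ell_E p \<phi> - ell_F p \<phi>) / (2 * p)) (at p)"
proof -
  have nz: "ell_delta p \<theta> \<noteq> 0" for \<theta>
    using ell_delta_pos[OF assms(1), of \<theta>] by simp
  have "(LBINT \<theta>=ereal 0..\<phi>. - ((sin \<theta>)\<^sup>2 / (2 * ell_delta p \<theta>)))
      = (ell_E p \<phi> - ell_F p \<phi>) / (2 * p) - (ell_E p 0 - ell_F p 0) / (2 * p)"
  proof (rule interval_integral_eq_antiderivative)
    show "continuous_on UNIV (\<lambda>\<theta>. - ((sin \<theta>)\<^sup>2 / (2 * ell_delta p \<theta>)))"
      using nz assms by (intro continuous_intros) auto
    show "((\<lambda>\<phi>. (ell_E p \<phi> - ell_F p \<phi>) / (2 * p)) has_real_derivative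
        - ((sin x)\<^sup>2 / (2 * ell_delta p x))) (at x)" for x
      using assms nz[of x] ell_delta_sq[OF assms(1), of x]
      by (auto intro!: derivative_eq_intros DERIV_ell_E_phi DERIV_ell_F_phi
          simp: divide_simps) (simp add: algebra_simps power2_eq_square)
  qed
  with DERIV_ell_E_p_integral[OF assms(1), of \<phi>] show ?thesis
    by simp
qed

lemma DERIV_ell_F_p_integral:
  assumes "p < 1"
  shows "((\<lambda>p. ell_F p \<phi>) has_real_derivative
      (LBINT \<theta>=ereal 0..\<phi>. (sin \<theta>)\<^sup>2 / (2 * ell_delta p \<theta> ^ 3))) (at p)"
proof -
  have nz: "ell_delta p \<theta> \<noteq> 0" if "p < 1" for p \<theta>
    using ell_delta_pos[OF that, of \<theta>] by simp
  have "((\<lambda>p. LBINT \<theta>=ereal 0..\<phi>. 1 / ell_delta p \<theta>) has_real_derivative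
      (LBINT \<theta>=ereal 0..\<phi>. (sin \<theta>)\<^sup>2 / (2 * ell_delta p \<theta> ^ 3))) (at p)"
  proof (rule interval_integral_has_field_derivative[where U="{..<1}"])
    show "((\<lambda>p. 1 / ell_delta p t) has_real_derivative (sin t)\<^sup>2 / (2 * ell_delta p t ^ 3)) (at p)"
      if "p \<in> {..<1}" for p t
      using that nz[of p t]
      by (auto intro!: derivative_eq_intros DERIV_ell_delta_p simp: divide_simps power2_eq_square power3_eq_cube)
  qed (use assms in \<open>auto intro!: continuous_intros simp: case_prod_unfold nz\<close>)
  then show ?thesis
    by (simp add: ell_F_def[abs_def] zero_ereal_def)
qed

text \<open>With \<open>d = ell_delta p \<theta>\<close> the differentiated integrand is
  \<open>(1 / d^3 - 1 / d) / (2 p)\<close>. The cubic term is removed by noting that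
  \<open>sin \<theta> cos \<theta> / d\<close> has derivative
  \<open>(d - (1 - p) / d^3) / p\<close>. This brings in \<open>ell_E\<close> and leaves the
  boundary term of \<open>ell_Fp\<close>.\<close>

lemma DERIV_ell_F_p:
  assumes "p < 1" "p \<noteq> 0"
  shows "((\<lambda>p. ell_F p \<phi>) has_real_derivative ell_Fp p \<phi>) (at p)"
proof -
  have nz: "ell_delta p \<theta> \<noteq> 0" for \<theta>
    using ell_delta_pos[OF assms(1), of \<theta>] by simp
  have "(LBINT \<theta>=ereal 0..\<phi>. (sin \<theta>)\<^sup>2 / (2 * ell_delta p \<theta> ^ 3)) = ell_Fp p \<phi> - ell_Fp p 0"
  proof (rule interval_integral_eq_antiderivative)
    show "continuous_on UNIV (\<lambda>\<theta>. (sin \<theta>)\<^sup>2 / (2 * ell_delta p \<theta> ^ 3))"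
      using nz assms by (intro continuous_intros) auto
    show "(ell_Fp p has_real_derivative (sin x)\<^sup>2 / (2 * ell_delta p x ^ 3)) (at x)" for x
    proof -
      define d where "d = ell_delta p x"
      define s where "s = sin x"
      define c where "c = cos x"
      have d: "d \<noteq> 0" "d\<^sup>2 = 1 - p * s\<^sup>2" and c: "c\<^sup>2 = 1 - s\<^sup>2"
        using nz[of x] ell_delta_sq[OF assms(1), of x]
        by (auto simp: d_def s_def c_def cos_squared_eq)
      have "(ell_Fp p has_real_derivative (d - (1 - p) * (1 / d)) / (2 * p * (1 - p))
         - ((c * c - s * s) * (2 * (1 - p) * d) - s * c * (2 * (1 - p) * (- p * s * c / d)))
             / ((2 * (1 - p) * d) * (2 * (1 - p) * d))) (at x)"
        unfolding ell_Fp_def[abs_def] d_def s_def c_def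
        using assms nz[of x]
        by (intro DERIV_diff DERIV_cdivide DERIV_cmult DERIV_divide DERIV_ell_E_phi DERIV_ell_F_phi
            DERIV_ell_delta_phi[OF assms(1)] DERIV_mult[OF DERIV_sin DERIV_cos, THEN DERIV_cong]) auto
      moreover have "(d - q * (1 / d)) / (2 * p * q)
          - ((c * c - s * s) * (2 * q * d) - s * c * (2 * q * (- p * s * c / d)))
             / ((2 * q * d) * (2 * q * d)) = s\<^sup>2 / (2 * d ^ 3)" if q: "q = 1 - p" for q
      proof -
        have "q \<noteq> 0" using assms q by simp
        have "d - q * (1 / d) = (d\<^sup>2 - q) / d"
          using d(1) by (simp add: field_simps power2_eq_square)
        also have "d\<^sup>2 - q = p * c\<^sup>2"
          unfolding c d(2) q by (simp add: algebra_simps)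
        finally have 1: "d - q * (1 / d) = p * c\<^sup>2 / d" .
        have "(c * c - s * s) * (2 * q * d) - s * c * (2 * q * (- p * s * c / d))
            = 2 * q * ((c\<^sup>2 - s\<^sup>2) * d\<^sup>2 + p * s\<^sup>2 * c\<^sup>2) / d"
          using d(1) by (simp add: field_simps power2_eq_square)
        also have "(c\<^sup>2 - s\<^sup>2) * d\<^sup>2 + p * s\<^sup>2 * c\<^sup>2 = c\<^sup>2 * d\<^sup>2 - q * s\<^sup>2"
          unfolding c d(2) q by (simp add: algebra_simps)
        finally have 2: "(c * c - s * s) * (2 * q * d) - s * c * (2 * q * (- p * s * c / d))
            = 2 * q * (c\<^sup>2 * d\<^sup>2 - q * s\<^sup>2) / d" .
        show ?thesis
          unfolding 1 2 using d(1) \<open>q \<noteq> 0\<close> assms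
          by (simp add: field_simps power2_eq_square power3_eq_cube)
      qed
      ultimately show ?thesis
        by (simp add: d_def s_def)
    qed
  qed
  moreover have "ell_Fp p 0 = 0"
    by (simp add: ell_Fp_def)
  ultimately show ?thesis
    using DERIV_ell_F_p_integral[OF assms(1), of \<phi>] by simp
qed

lemma has_derivative_ell_F:
  assumes "0 < p" "p < 1"
  shows "((\<lambda>(p, \<phi>). ell_F p \<phi>) has_derivative
           (\<lambda>(dp, d\<phi>). ell_Fp p \<phi> * dp + 1 / ell_delta p \<phi> * d\<phi>)) (at (p, \<phi>))"
proof (rule has_derivative_joint[where U="{..<1}"])
  show "continuous_on ({..<1} \<times> UNIV) (\<lambda>(p, \<phi>). 1 / ell_delta p \<phi>)"
    using ell_delta_pos by (auto simp: case_prod_unfold less_imp_neq[symmetric] intro!: continuous_intros)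
qed (use assms in \<open>auto intro: DERIV_ell_F_p DERIV_ell_F_phi\<close>)

lemma has_derivative_ell_E:
  assumes "0 < p" "p < 1"
  shows "((\<lambda>(p, \<phi>). ell_E p \<phi>) has_derivative
           (\<lambda>(dp, d\<phi>). (ell_E p \<phi> - ell_F p \<phi>) / (2 * p) * dp + ell_delta p \<phi> * d\<phi>)) (at (p, \<phi>))"
proof (rule has_derivative_joint[where U="{..<1}"])
  show "continuous_on ({..<1} \<times> UNIV) (\<lambda>(p, \<phi>). ell_delta p \<phi>)"
    by (auto simp: case_prod_unfold intro!: continuous_intros)
qed (use assms in \<open>auto intro: DERIV_ell_E_p DERIV_ell_E_phi\<close>)

text \<open>Injectivity of \<open>g\<close> on the values of \<open>f\<close> prevents smaller
  periods from appearing. It allows for an amplitude factor and, on positive values, for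
  squaring.\<close>

lemma fundamental_period_rescale:
  fixes f :: "real \<Rightarrow> 'a"
  assumes f: "fundamental_period f p" and b: "0 < b" and g: "inj_on g (range f)"
  shows "fundamental_period (\<lambda>x. g (f (b * x))) (p / b)"
  unfolding fundamental_period_def
proof (intro conjI allI impI)
  show "0 < p / b" using f b by (simp add: fundamental_period_def)
  show "g (f (b * (x + p / b))) = g (f (b * x))" for x
    using f b by (simp add: fundamental_period_def distrib_left)
  fix q assume q: "0 < q \<and> q < p / b"
  then have "0 < b * q" "b * q < p" using b by (auto simp: field_simps)
  then obtain x where x: "f (x + b * q) \<noteq> f x"
    using f unfolding fundamental_period_def by blast
  have "b * (x / b + q) = x + b * q" "b * (x / b) = x"
    using b by (auto simp: field_simps)
  then have "g (f (b * (x / b + q))) \<noteq> g (f (b * (x / b)))"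
    using x g by (auto simp: inj_on_eq_iff)
  then show "\<exists>x. g (f (b * (x + q))) \<noteq> g (f (b * x))" by blast
qed

section \<open>The amplitude as inverse of the incomplete integral\<close>

lemma isCont_ell_F_p: "p < 1 \<Longrightarrow> isCont (\<lambda>p. ell_F p \<phi>) p"
  using DERIV_ell_F_p_integral DERIV_isCont by blast

lemma isCont_ell_E_p: "p < 1 \<Longrightarrow> isCont (\<lambda>p. ell_E p \<phi>) p"
  using DERIV_ell_E_p_integral DERIV_isCont by blast

lemma ell_F_strict_mono: "p < 1 \<Longrightarrow> strict_mono (ell_F p)"
  by (rule strict_monoI, rule DERIV_pos_imp_increasing)
    (auto intro!: exI DERIV_ell_F_phi simp: ell_delta_pos)

lemma isCont_ell_F_phi: "p < 1 \<Longrightarrow> isCont (ell_F p) \<phi>"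
  using DERIV_ell_F_phi DERIV_isCont by blast

lemma ell_F_minus:
  assumes "p < 1"
  shows "ell_F p (- \<phi>) = - ell_F p \<phi>"
proof -
  have "\<forall>x. ((\<lambda>\<phi>. ell_F p (- \<phi>) + ell_F p \<phi>) has_real_derivative 0) (at x)"
    by (auto intro!: derivative_eq_intros DERIV_chain2[OF DERIV_ell_F_phi[OF assms]] DERIV_ell_F_phi[OF assms]
        simp: ell_delta_def)
  from DERIV_isconst_all[OF this, of \<phi> 0] show ?thesis by simp
qed

definition complete_K :: "real \<Rightarrow> real" where
  "complete_K p = ell_F p (pi / 2)"

definition complete_E :: "real \<Rightarrow> real" where
  "complete_E p = ell_E p (pi / 2)"

lemma ell_F_add_pi:
  assumes "p < 1"
  shows "ell_F p (\<phi> + pi) = ell_F p \<phi> + 2 * complete_K p"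
proof -
  have "\<forall>x. ((\<lambda>\<phi>. ell_F p (\<phi> + pi) - ell_F p \<phi>) has_real_derivative 0) (at x)"
    by (auto intro!: derivative_eq_intros DERIV_chain2[OF DERIV_ell_F_phi[OF assms]] DERIV_ell_F_phi[OF assms]
        simp: ell_delta_def)
  \<comment> \<open>At \<open>- pi / 2\<close> oddness evaluates the constant difference as
    \<open>K + K\<close>.\<close>
  from DERIV_isconst_all[OF this, of \<phi> "- (pi / 2)"] show ?thesis
    by (simp add: ell_F_minus[OF assms] complete_K_def)
qed

text \<open>For \<open>p \<ge> 0\<close> the integrand is at least 1. The bound makes
  \<open>ell_F p\<close> unbounded in both directions, hence onto, and gives positivity of
  \<open>K\<close>.\<close>

lemma ell_F_ge:
  assumes "0 \<le> p" "p < 1" "0 \<le> \<phi>"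
  shows "\<phi> \<le> ell_F p \<phi>"
proof -
  have "ell_F p 0 - 0 \<le> ell_F p \<phi> - \<phi>"
  proof (rule DERIV_nonneg_imp_nondecreasing[OF assms(3), where f="\<lambda>\<phi>. ell_F p \<phi> - \<phi>"])
    fix x :: real
    have "ell_delta p x \<le> 1"
      using assms by (simp add: ell_delta_def)
    then have "0 \<le> 1 / ell_delta p x - 1"
      using ell_delta_pos[OF assms(2), of x] by simp
    then show "\<exists>y. ((\<lambda>\<phi>. ell_F p \<phi> - \<phi>) has_real_derivative y) (at x) \<and> 0 \<le> y"
      using DERIV_diff[OF DERIV_ell_F_phi[OF assms(2), of x] DERIV_ident] by blast
  qed
  then show ?thesis by simp
qed

lemma complete_K_pos: "0 \<le> p \<Longrightarrow> p < 1 \<Longrightarrow> 0 < complete_K p"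
  using ell_F_ge[of p "pi / 2"] pi_gt_zero by (simp add: complete_K_def del: pi_gt_zero)

lemma ex1_ell_F:
  assumes "0 \<le> p" "p < 1"
  shows "\<exists>!\<phi>. ell_F p \<phi> = u"
proof (rule ex_ex1I)
  have le: "- \<bar>u\<bar> \<le> \<bar>u\<bar>" "ell_F p (- \<bar>u\<bar>) \<le> u" "u \<le> ell_F p \<bar>u\<bar>"
    using ell_F_ge[OF assms, of "\<bar>u\<bar>"] ell_F_minus[OF assms(2), of "\<bar>u\<bar>"] by auto
  show "\<exists>\<phi>. ell_F p \<phi> = u"
    using IVT[OF le(2,3,1)] isCont_ell_F_phi[OF assms(2)] by blast
  show "\<phi> = \<psi>" if "ell_F p \<phi> = u" "ell_F p \<psi> = u" for \<phi> \<psi>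
    using that strict_mono_eq[OF ell_F_strict_mono[OF assms(2)]] by auto
qed

definition ell_am :: "real \<Rightarrow> real \<Rightarrow> real" where
  "ell_am p u = (THE \<phi>. ell_F p \<phi> = u)"

lemma jacobi_am_eq: "jacobi_am k u = ell_am (k\<^sup>2) u"
  by (simp add: jacobi_am_def ell_am_def ellip_F_def ell_F_def ell_delta_def)

lemma jacobi_dn_eq: "jacobi_dn k u = ell_delta (k\<^sup>2) (ell_am (k\<^sup>2) u)"
  by (simp add: jacobi_dn_def jacobi_sn_def jacobi_am_eq ell_delta_def)

lemma ell_F_am [simp]: "0 \<le> p \<Longrightarrow> p < 1 \<Longrightarrow> ell_F p (ell_am p u) = u"
  unfolding ell_am_def by (rule theI'[OF ex1_ell_F])

lemma ell_am_F [simp]: "0 \<le> p \<Longrightarrow> p < 1 \<Longrightarrow> ell_am p (ell_F p \<phi>) = \<phi>"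
  using ell_F_am[of p "ell_F p \<phi>"] strict_mono_eq[OF ell_F_strict_mono[of p]] by blast

lemma ell_am_add_period:
  assumes "0 \<le> p" "p < 1"
  shows "ell_am p (u + 2 * complete_K p) = ell_am p u + pi"
  using ell_am_F[OF assms, of "ell_am p u + pi"] ell_F_add_pi[OF assms(2), of "ell_am p u"] assms
  by simp

lemma ell_am_0 [simp]: "0 \<le> p \<Longrightarrow> p < 1 \<Longrightarrow> ell_am p 0 = 0"
  using ell_am_F[of p 0] by simp

lemma ell_am_strict_mono:
  assumes "0 \<le> p" "p < 1" "u < v"
  shows "ell_am p u < ell_am p v"
  using strict_mono_less[OF ell_F_strict_mono[OF assms(2)], of "ell_am p u" "ell_am p v"] assms by simp

lemma ell_delta_add_pi: "ell_delta p (\<phi> + pi) = ell_delta p \<phi>"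
  by (simp add: ell_delta_def)

text \<open>Advancing by \<open>2 K\<close> adds \<open>pi\<close> to the amplitude, which leaves
  the squared sine unchanged. No smaller \<open>q\<close> is a period, because the value at 0 is 1,
  whereas the amplitude at \<open>q\<close> lies strictly between 0 and \<open>pi\<close> and the
  value there is below 1.\<close>

lemma fundamental_period_ell_delta_am:
  assumes p: "0 < p" "p < 1"
  shows "fundamental_period (\<lambda>u. ell_delta p (ell_am p u)) (2 * complete_K p)"
  unfolding fundamental_period_def
proof (intro conjI allI impI)
  show "0 < 2 * complete_K p"
    using p complete_K_pos[of p] by simp
  show "ell_delta p (ell_am p (x + 2 * complete_K p)) = ell_delta p (ell_am p x)" for x
    using p by (simp add: ell_am_add_period ell_delta_add_pi)
  fix q assume q: "0 < q \<and> q < 2 * complete_K p"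
  have "0 < ell_am p q" "ell_am p q < pi"
    using ell_am_strict_mono[of p 0 q] ell_am_strict_mono[of p q "2 * complete_K p"]
      ell_am_add_period[of p 0] p q by auto
  then have "0 < sin (ell_am p q)" by (rule sin_gt_zero)
  then have "ell_delta p (ell_am p q) < 1"
    using p by (simp add: ell_delta_def)
  then show "\<exists>x. ell_delta p (ell_am p (x + q)) \<noteq> ell_delta p (ell_am p x)"
    using p by (intro exI[of _ 0]) (auto simp: ell_delta_def)
qed

text \<open>Keeping \<open>p\<close> as a coordinate turns the amplitude into the inverse of the
  planar map \<open>(p, \<phi>) \<mapsto> (p, ell_F p \<phi>)\<close>. Its derivative is triangular
  with nonzero diagonal, so the inverse function theorem gives the dependence on \<open>u\<close>
  and on the parameter together.\<close>

lemma has_derivative_ell_am: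
  fixes p u :: real
  assumes "0 < p" "p < 1"
  defines "a \<equiv> ell_am p u"
  shows "((\<lambda>(p, u). ell_am p u) has_derivative
           (\<lambda>(dp, du). ell_delta p a * (du - ell_Fp p a * dp))) (at (p, u))"
proof -
  define f where "f = (\<lambda>(p, \<phi>). (p, ell_F p \<phi>))"
  define g where "g = (\<lambda>(p, u). (p, ell_am p u))"
  define f' where "f' p \<phi> = (\<lambda>(dp, d\<phi>). (dp, ell_Fp p \<phi> * dp + 1 / ell_delta p \<phi> * d\<phi>))" for p \<phi>
  define g' where "g' = (\<lambda>(dp, du). (dp, ell_delta p a * (du - ell_Fp p a * dp)))"
  define U where "U = {0<..<1::real} \<times> (UNIV :: real set)"
  have f': "(f has_derivative f' p \<phi>) (at (p, \<phi>))" if "0 < p" "p < 1" for p \<phi>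
    using has_derivative_Pair[OF has_derivative_fst[OF has_derivative_ident] has_derivative_ell_F[OF that, of \<phi>]]
    by (simp add: f_def f'_def case_prod_unfold)
  have "(g has_derivative g') (at (f (p, a)))"
  proof (rule has_derivative_inverse_strong[where f=f and x="(p, a)"])
    show "open U" by (simp add: U_def open_Times)
    show "(p, a) \<in> U" using assms by (simp add: U_def)
    show "continuous_on U f"
      using f' has_derivative_continuous by (fastforce simp: U_def intro!: continuous_at_imp_continuous_on)
    show "g (f x) = x" if "x \<in> U" for x
      using that by (auto simp: U_def f_def g_def)
    show "(f has_derivative f' p a) (at (p, a))" using f' assms by simp
    show "f' p a \<circ> g' = id"
      using ell_delta_pos[OF assms(2), of a] by (auto simp: f'_def g'_def fun_eq_iff)
  qed
  moreover have "f (p, a) = (p, u)"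
    using assms by (simp add: f_def)
  ultimately have "((\<lambda>x. snd (g x)) has_derivative (\<lambda>x. snd (g' x))) (at (p, u))"
    using has_derivative_snd by force
  then show ?thesis
    by (simp add: g_def g'_def case_prod_unfold)
qed

text \<open>The substitution is \<open>t = sin \<theta>\<close>. The integrand is singular at
  \<open>t = 1\<close>, so the fundamental theorem is applied on the open interval to the
  antiderivative \<open>ell_F (k^2) (arcsin t)\<close>, which has limits at both ends.\<close>

lemma ellip_K_eq:
  assumes "0 < k" "k < 1"
  shows "ellip_K k = complete_K (k\<^sup>2)"
proof -
  have p: "k\<^sup>2 < 1"
    using assms by (simp add: abs_square_less_1)
  define F where "F = (\<lambda>t. ell_F (k\<^sup>2) (arcsin t))"
  have cont: "continuous_on {-1..1} F"
    unfolding F_def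
    by (rule continuous_on_compose2[of UNIV "ell_F (k\<^sup>2)"])
      (auto intro!: continuous_at_imp_continuous_on isCont_ell_F_phi p continuous_on_arcsin')
  have "(LBINT t=0..1. 1 / sqrt ((1 - t\<^sup>2) * (1 - k\<^sup>2 * t\<^sup>2))) = complete_K (k\<^sup>2) - 0"
  proof (rule interval_integral_FTC_nonneg(2)[where F=F])
    fix t assume "0 < ereal t" "ereal t < 1"
    then have t: "0 < t" "t < 1" by (simp_all add: zero_ereal_def one_ereal_def)
    have *: "0 < 1 - t\<^sup>2" "0 < 1 - k\<^sup>2 * t\<^sup>2"
      using t delta_sq_pos[OF p, of "arcsin t"] by (auto simp: abs_square_less_1)
    have "(F has_real_derivative (1 / ell_delta (k\<^sup>2) (arcsin t)) * inverse (sqrt (1 - t\<^sup>2))) (at t)"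
      unfolding F_def by (rule DERIV_chain2[OF DERIV_ell_F_phi[OF p] DERIV_arcsin]) (use t in auto)
    then show "(F has_real_derivative 1 / sqrt ((1 - t\<^sup>2) * (1 - k\<^sup>2 * t\<^sup>2))) (at t)"
      using t by (simp add: ell_delta_def real_sqrt_mult divide_inverse mult.commute)
    show "isCont (\<lambda>t. 1 / sqrt ((1 - t\<^sup>2) * (1 - k\<^sup>2 * t\<^sup>2))) t"
      using * by (intro continuous_intros) auto
  next
    show "AE t in lborel. 0 < ereal t \<longrightarrow> ereal t < 1 \<longrightarrow> 0 \<le> 1 / sqrt ((1 - t\<^sup>2) * (1 - k\<^sup>2 * t\<^sup>2))"
    proof (intro AE_I2 impI)
      fix t assume "0 < ereal t" "ereal t < 1"
      then have t: "0 < t" "t < 1" by (simp_all add: zero_ereal_def one_ereal_def)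
      have "0 < 1 - t\<^sup>2" "0 < 1 - k\<^sup>2 * t\<^sup>2"
        using t delta_sq_pos[OF p, of "arcsin t"] by (auto simp: abs_square_less_1)
      then show "0 \<le> 1 / sqrt ((1 - t\<^sup>2) * (1 - k\<^sup>2 * t\<^sup>2))" by simp
    qed
    have "(F \<longlongrightarrow> F 0) (at_right 0)"
      by (rule continuous_on_Icc_at_rightD[of 0 1]) (auto intro: continuous_on_subset[OF cont])
    then show "((F \<circ> real_of_ereal) \<longlongrightarrow> 0) (at_right 0)"
      by (simp add: zero_ereal_def ereal_tendsto_simps F_def)
    have "(F \<longlongrightarrow> F 1) (at_left 1)"
      by (rule continuous_on_Icc_at_leftD[of 0 1]) (auto intro: continuous_on_subset[OF cont])
    then show "((F \<circ> real_of_ereal) \<longlongrightarrow> complete_K (k\<^sup>2)) (at_left 1)"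
      by (simp add: one_ereal_def ereal_tendsto_simps F_def complete_K_def)
  qed auto
  then show ?thesis by (simp add: ellip_K_def)
qed

section \<open>Complete integrals: derivatives, inequalities, growth\<close>

lemma DERIV_complete_K:
  assumes "0 < p" "p < 1"
  shows "(complete_K has_real_derivative (complete_E p - (1 - p) * complete_K p) / (2 * p * (1 - p))) (at p)"
  using DERIV_ell_F_p[of p "pi / 2"] assms
  by (simp add: complete_K_def[abs_def] complete_E_def ell_Fp_def)

lemma DERIV_complete_E:
  assumes "0 < p" "p < 1"
  shows "(complete_E has_real_derivative (complete_E p - complete_K p) / (2 * p)) (at p)"
  using DERIV_ell_E_p[of p "pi / 2"] assms
  by (simp add: complete_K_def complete_E_def[abs_def])

lemma complete_E_less_K:
  assumes "0 < p" "p < 1"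
  shows "complete_E p < complete_K p"
proof -
  have "ell_F p 0 - ell_E p 0 < ell_F p (pi / 2) - ell_E p (pi / 2)"
  proof (rule DERIV_pos_imp_increasing_open[where f="\<lambda>\<phi>. ell_F p \<phi> - ell_E p \<phi>"])
    fix x :: real assume x: "0 < x" "x < pi / 2"
    define d where "d = ell_delta p x"
    have "0 < sin x" using x by (intro sin_gt_zero) auto
    then have "0 < d" "d < 1"
      using assms ell_delta_pos[of p x] by (auto simp: ell_delta_def d_def)
    then have "1 < 1 / d" by simp
    then have "0 < 1 / d - d" using \<open>d < 1\<close> by linarith
    then show "\<exists>y. ((\<lambda>\<phi>. ell_F p \<phi> - ell_E p \<phi>) has_real_derivative y) (at x) \<and> 0 < y"
      unfolding d_def using DERIV_diff[OF DERIV_ell_F_phi[OF assms(2), of x] DERIV_ell_E_phi] by blast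
  next
    have "isCont (\<lambda>\<phi>. ell_F p \<phi> - ell_E p \<phi>) x" for x
      using DERIV_isCont[OF DERIV_diff[OF DERIV_ell_F_phi[OF assms(2)] DERIV_ell_E_phi]] .
    then show "continuous_on {0..pi / 2} (\<lambda>\<phi>. ell_F p \<phi> - ell_E p \<phi>)"
      by (auto intro: continuous_at_imp_continuous_on)
  qed simp
  then show ?thesis by (simp add: complete_E_def complete_K_def)
qed

lemma ell_E_0_left: "ell_E 0 \<phi> = \<phi>" and ell_F_0_left: "ell_F 0 \<phi> = \<phi>"
proof -
  have "(LBINT x=ereal 0..\<phi>. 1) = \<phi> - 0"
    by (rule interval_integral_eq_antiderivative) auto
  then show "ell_E 0 \<phi> = \<phi>" "ell_F 0 \<phi> = \<phi>"
    by (simp_all add: ell_E_def ell_F_def ell_delta_def zero_ereal_def)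
qed

lemma continuous_on_complete:
  "continuous_on {..<1} complete_K" "continuous_on {..<1} complete_E"
  using isCont_ell_F_p isCont_ell_E_p
  by (auto simp: complete_K_def[abs_def] complete_E_def[abs_def] intro!: continuous_at_imp_continuous_on)

text \<open>The difference of the two sides vanishes at \<open>p = 0\<close> and has derivative \<open>3 (K - E) / 2 > 0\<close>.\<close>

lemma complete_E_K_ineq:
  assumes "0 < p" "p < 1"
  shows "2 * (1 - p) * complete_K p < (2 - p) * complete_E p"
proof -
  define h where "h = (\<lambda>p. (2 - p) * complete_E p - 2 * (1 - p) * complete_K p)"
  have "h 0 < h p"
  proof (rule DERIV_pos_imp_increasing_open[where f=h])
    fix x assume "0 < x" "x < p"
    then have x: "0 < x" "x < 1" using assms by auto
    have h': "(h has_real_derivative - complete_E x + (2 - x) * ((complete_E x - complete_K x) / (2 * x))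
        - (2 * (- 1) * complete_K x + 2 * (1 - x) * ((complete_E x - (1 - x) * complete_K x) / (2 * x * (1 - x)))))
        (at x)"
      unfolding h_def
      by (rule derivative_eq_intros DERIV_complete_E DERIV_complete_K x refl)+ (simp add: mult.commute)
    have alg: "- e + (2 - x) * ((e - k) / (2 * x))
        - (2 * (- 1) * k + 2 * (1 - x) * ((e - (1 - x) * k) / (2 * x * (1 - x)))) = 3 * (k - e) / 2" for e k
    proof -
      have cancel: "2 * q * (m / (2 * x * q)) = m / x" if "q \<noteq> 0" for q m :: real
        using that by simp
      have "2 * (1 - x) * ((e - (1 - x) * k) / (2 * x * (1 - x))) = (e - (1 - x) * k) / x"
        by (rule cancel) (use x in simp)
      then show ?thesis
        using x by (simp add: field_simps)
    qed
    have "(h has_real_derivative 3 * (complete_K x - complete_E x) / 2) (at x)"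
      using h' by (simp only: alg)
    moreover have "0 < 3 * (complete_K x - complete_E x) / 2"
      using complete_E_less_K[OF x] by simp
    ultimately show "\<exists>y. (h has_real_derivative y) (at x) \<and> 0 < y" by blast
  next
    show "continuous_on {0..p} h"
      unfolding h_def
      by (intro continuous_intros continuous_on_subset[OF continuous_on_complete(1)]
          continuous_on_subset[OF continuous_on_complete(2)]) (use assms in auto)
  qed (use assms in auto)
  then show ?thesis
    by (simp add: h_def complete_K_def complete_E_def ell_E_0_left ell_F_0_left)
qed

lemma complete_E_ge_1:
  assumes "p < 1"
  shows "1 \<le> complete_E p"
proof -
  have "ell_E p 0 - sin 0 \<le> ell_E p (pi / 2) - sin (pi / 2)"
  proof (rule DERIV_nonneg_imp_nondecreasing[where f="\<lambda>\<phi>. ell_E p \<phi> - sin \<phi>"])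
    fix x :: real
    have "cos x \<le> ell_delta p x"
    proof (unfold ell_delta_def, rule real_le_rsqrt)
      have "p * (sin x)\<^sup>2 \<le> 1 * (sin x)\<^sup>2"
        using assms by (intro mult_right_mono) auto
      then show "(cos x)\<^sup>2 \<le> 1 - p * (sin x)\<^sup>2"
        by (simp add: cos_squared_eq)
    qed
    then show "\<exists>y. ((\<lambda>x. ell_E p x - sin x) has_real_derivative y) (at x) \<and> 0 \<le> y"
      using DERIV_diff[OF DERIV_ell_E_phi[of p x] DERIV_sin[of x]] by (intro exI conjI) auto
  qed simp
  then show ?thesis by (simp add: complete_E_def)
qed

text \<open>The inequality \<open>2 (1 - p) K < (2 - p) E\<close> together with
  \<open>E \<ge> 1\<close> gives \<open>E - (1 - p) K \<ge> p / 2\<close>, so \<open>K\<close> has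
  derivative at least \<open>1 / (4 (1 - p))\<close>. Integrating from 0 yields the bound, whose
  only purpose is to show that \<open>K\<close> is unbounded as \<open>p\<close> tends to 1.\<close>

lemma complete_K_lower_bound:
  assumes "0 \<le> p" "p < 1"
  shows "- ln (1 - p) / 4 \<le> complete_K p"
proof -
  have "complete_K 0 + ln (1 - 0) / 4 \<le> complete_K p + ln (1 - p) / 4"
  proof (rule DERIV_nonneg_imp_increasing_open[where f="\<lambda>p. complete_K p + ln (1 - p) / 4"])
    fix x assume "0 < x" "x < p"
    then have x: "0 < x" "x < 1" using assms by auto
    have "(1 - x) * complete_K x \<le> (2 - x) / 2 * complete_E x"
      using complete_E_K_ineq[OF x] by linarith
    also have "(2 - x) / 2 * complete_E x = complete_E x - x / 2 * complete_E x"
      by (simp add: field_simps)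
    finally have "x / 2 \<le> complete_E x - (1 - x) * complete_K x"
      using mult_left_mono[OF complete_E_ge_1[of x], of "x / 2"] x by linarith
    then have "(x / 2) / (2 * x * (1 - x)) \<le> (complete_E x - (1 - x) * complete_K x) / (2 * x * (1 - x))"
      using x by (intro divide_right_mono) auto
    moreover have "(x / 2) / (2 * x * (1 - x)) = 1 / (1 - x) / 4"
      using x by (simp add: divide_simps)
    ultimately have "0 \<le> (complete_E x - (1 - x) * complete_K x) / (2 * x * (1 - x)) + - 1 / (1 - x) / 4"
      by simp
    moreover have "((\<lambda>p. ln (1 - p) / 4) has_real_derivative - 1 / (1 - x) / 4) (at x)"
      using x by (auto intro!: derivative_eq_intros simp: divide_simps)
    then have "((\<lambda>p. complete_K p + ln (1 - p) / 4) has_real_derivative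
       (complete_E x - (1 - x) * complete_K x) / (2 * x * (1 - x)) + - 1 / (1 - x) / 4) (at x)"
      by (intro DERIV_add DERIV_complete_K x)
    ultimately show "\<exists>y. ((\<lambda>p. complete_K p + ln (1 - p) / 4) has_real_derivative y) (at x) \<and> 0 \<le> y"
      by blast
  next
    show "continuous_on {0..p} (\<lambda>p. complete_K p + ln (1 - p) / 4)"
      by (intro continuous_intros continuous_on_subset[OF continuous_on_complete(1)]) (use assms in auto)
  qed (use assms in auto)
  moreover have "0 < complete_K 0" by (rule complete_K_pos) auto
  ultimately show ?thesis by simp
qed

section \<open>The curve of solutions of the period equation\<close>

definition branch_sigma :: "real \<Rightarrow> real \<Rightarrow> real" where
  "branch_sigma L p = 4 * (complete_K p)\<^sup>2 * (2 - p) / L\<^sup>2"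

definition branch_eta :: "real \<Rightarrow> real \<Rightarrow> real \<Rightarrow> real" where
  "branch_eta c L p = 4 * sqrt c / L * sqrt (1 - p) * complete_K p"

text \<open>The derivative of \<open>branch_sigma\<close>, factored so that its sign can be read off
  from \<open>complete_E_K_ineq\<close>.\<close>

definition branch_sigma' :: "real \<Rightarrow> real \<Rightarrow> real" where
  "branch_sigma' L p = 4 / L\<^sup>2 * (complete_K p / (p * (1 - p)))
     * ((2 - p) * complete_E p - 2 * (1 - p) * complete_K p)"

lemma DERIV_branch_sigma:
  assumes "0 < L" "0 < p" "p < 1"
  shows "(branch_sigma L has_real_derivative branch_sigma' L p) (at p)"
proof -
  let ?K = "complete_K p" and ?E = "complete_E p"
  have "(branch_sigma L has_real_derivative
      (4 * (2 * ?K * ((?E - (1 - p) * ?K) / (2 * p * (1 - p)))) * (2 - p) - 4 * ?K\<^sup>2) / L\<^sup>2) (at p)"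
    unfolding branch_sigma_def[abs_def]
    by (rule DERIV_cdivide, rule DERIV_mult[OF DERIV_cmult[OF DERIV_power[OF DERIV_complete_K[OF assms(2,3)]]]
          DERIV_diff[OF DERIV_const DERIV_ident], THEN DERIV_cong]) (simp add: mult_ac)
  moreover have "(4 * (2 * k * ((e - q * k) / (2 * p * q))) * (2 - p) - 4 * k\<^sup>2) / L\<^sup>2
      = 4 / L\<^sup>2 * (k / (p * q)) * ((2 - p) * e - 2 * q * k)" if "q = 1 - p" for q k e
  proof -
    have q: "q \<noteq> 0" "p \<noteq> 0" "2 - p = 1 + q" "p + q = 1" using assms that by auto
    have "(4 * (2 * k * ((e - q * k) / (2 * p * q))) * (2 - p) - 4 * k\<^sup>2)
        = 4 * (k / (p * q)) * ((e - q * k) * (2 - p) - k * (p * q))"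
      using q(1,2) by (simp add: divide_simps) (simp add: algebra_simps power2_eq_square)
    also have "(e - q * k) * (2 - p) - k * (p * q) = (2 - p) * e - q * k * (2 - p + p)"
      by (simp add: algebra_simps)
    finally show ?thesis by (simp add: mult_ac)
  qed
  ultimately show ?thesis
    by (simp add: branch_sigma'_def)
qed

lemma branch_sigma'_pos:
  assumes "0 < L" "0 < p" "p < 1"
  shows "0 < branch_sigma' L p"
  unfolding branch_sigma'_def using assms complete_E_K_ineq[of p] complete_K_pos[of p]
  by (intro mult_pos_pos divide_pos_pos) auto

lemma continuous_on_branch_sigma: "p < 1 \<Longrightarrow> continuous_on {q..p} (branch_sigma L)"
  unfolding branch_sigma_def[abs_def] divide_inverse
  by (intro continuous_intros continuous_on_subset[OF continuous_on_complete(1)]) auto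

lemma branch_sigma_strict_mono:
  assumes "0 < L" "0 \<le> p" "p < q" "q < 1"
  shows "branch_sigma L p < branch_sigma L q"
proof (rule DERIV_pos_imp_increasing_open[OF assms(3) _ continuous_on_branch_sigma[OF assms(4)]])
  fix x assume "p < x" "x < q"
  then show "\<exists>y. (branch_sigma L has_real_derivative y) (at x) \<and> 0 < y"
    using assms by (intro exI[of _ "branch_sigma' L x"] conjI DERIV_branch_sigma branch_sigma'_pos) auto
qed

lemma branch_sigma_0: "branch_sigma L 0 = 2 * pi\<^sup>2 / L\<^sup>2"
  by (simp add: branch_sigma_def complete_K_def ell_F_0_left power2_eq_square)

lemma branch_sigma_gt:
  assumes "0 < L" "0 < p" "p < 1"
  shows "2 * pi\<^sup>2 / L\<^sup>2 < branch_sigma L p"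
  using branch_sigma_strict_mono[of L 0 p] assms by (simp add: branch_sigma_0)

lemma branch_sigma_surj:
  assumes L: "0 < L" and \<sigma>: "2 * pi\<^sup>2 / L\<^sup>2 < \<sigma>"
  obtains p where "0 < p" "p < 1" "branch_sigma L p = \<sigma>"
proof -
  have \<sigma>0: "0 < \<sigma>"
    using \<sigma> by (rule le_less_trans[rotated]) simp
  \<comment> \<open>\<open>M\<close> solves \<open>4 M^2 / L^2 = \<sigma>\<close>, and the
    \<open>p\<close> below is chosen so that the logarithmic lower bound for \<open>K\<close> is
    exactly \<open>M\<close>. Since \<open>2 - p > 1\<close>, \<open>branch_sigma L p\<close> is at
    least \<sigma>, as the intermediate value theorem requires.\<close>
  define M where "M = L * sqrt \<sigma> / 2"
  have M: "0 < M" using L \<sigma>0 by (simp add: M_def)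
  define p where "p = 1 - exp (- 4 * M)"
  have p: "0 < p" "p < 1" using M by (auto simp: p_def)
  have "M \<le> complete_K p"
    using complete_K_lower_bound[of p] p by (simp add: p_def)
  then have "M\<^sup>2 * 1 \<le> (complete_K p)\<^sup>2 * (2 - p)"
    using M p by (intro mult_mono power_mono) auto
  then have "4 * (M\<^sup>2 * 1) / L\<^sup>2 \<le> 4 * ((complete_K p)\<^sup>2 * (2 - p)) / L\<^sup>2"
    by (intro divide_right_mono mult_left_mono) auto
  moreover have "4 * (M\<^sup>2 * 1) / L\<^sup>2 = \<sigma>"
    using L \<sigma>0 by (simp add: M_def power_divide power_mult_distrib)
  ultimately have "\<sigma> \<le> branch_sigma L p"
    by (simp add: branch_sigma_def)
  then obtain q where q: "0 \<le> q" "q \<le> p" "branch_sigma L q = \<sigma>"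
    using IVT'[of "branch_sigma L" 0 \<sigma> p] \<sigma> p continuous_on_branch_sigma[OF p(2)]
    by (auto simp: branch_sigma_0)
  moreover have "q \<noteq> 0" using q(3) \<sigma> branch_sigma_0 by force
  ultimately show thesis using that[of q] p by simp
qed

section \<open>The parameter as a function of \<sigma>\<close>

definition branch_p :: "real \<Rightarrow> real \<Rightarrow> real" where
  "branch_p L \<sigma> = (THE p. 0 < p \<and> p < 1 \<and> branch_sigma L p = \<sigma>)"

lemma branch_p_branch_sigma [simp]:
  assumes "0 < L" "0 < p" "p < 1"
  shows "branch_p L (branch_sigma L p) = p"
  unfolding branch_p_def
proof (rule the_equality)
  show "q = p" if "0 < q \<and> q < 1 \<and> branch_sigma L q = branch_sigma L p" for q
    using that branch_sigma_strict_mono[of L p q] branch_sigma_strict_mono[of L q p] assms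
    by (cases p q rule: linorder_cases) auto
qed (use assms in simp)

lemma branch_p:
  assumes "0 < L" "2 * pi\<^sup>2 / L\<^sup>2 < \<sigma>"
  shows "0 < branch_p L \<sigma>" "branch_p L \<sigma> < 1" "branch_sigma L (branch_p L \<sigma>) = \<sigma>"
proof -
  obtain p where "0 < p" "p < 1" "branch_sigma L p = \<sigma>"
    using branch_sigma_surj[OF assms] .
  then show "0 < branch_p L \<sigma>" "branch_p L \<sigma> < 1" "branch_sigma L (branch_p L \<sigma>) = \<sigma>"
    using branch_p_branch_sigma[OF assms(1), of p] by auto
qed

lemma branch_p_strict_mono:
  assumes "0 < L" "2 * pi\<^sup>2 / L\<^sup>2 < \<sigma>" "\<sigma> < \<tau>"
  shows "branch_p L \<sigma> < branch_p L \<tau>"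
proof (rule ccontr)
  assume "\<not> ?thesis"
  then have "branch_sigma L (branch_p L \<tau>) \<le> branch_sigma L (branch_p L \<sigma>)"
    using branch_sigma_strict_mono[of L "branch_p L \<tau>" "branch_p L \<sigma>"]
      branch_p[of L \<sigma>] branch_p[of L \<tau>] assms by (cases "branch_p L \<tau> = branch_p L \<sigma>") auto
  then show False
    using branch_p(3)[of L \<sigma>] branch_p(3)[of L \<tau>] assms by simp
qed

lemma DERIV_branch_p:
  assumes "0 < L" "2 * pi\<^sup>2 / L\<^sup>2 < \<sigma>"
  shows "(branch_p L has_real_derivative inverse (branch_sigma' L (branch_p L \<sigma>))) (at \<sigma>)"
proof -
  let ?p = "branch_p L \<sigma>"
  note p = branch_p[OF assms]
  have pos: "0 < branch_sigma' L ?p" by (rule branch_sigma'_pos[OF assms(1) p(1,2)])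
  have "(branch_p L has_derivative (*) (inverse (branch_sigma' L ?p))) (at (branch_sigma L ?p))"
  proof (rule has_derivative_inverse_strong[where f="branch_sigma L" and S="{0<..<1}" and x="?p"])
    show "continuous_on {0<..<1} (branch_sigma L)"
      using DERIV_isCont[OF DERIV_branch_sigma[OF assms(1)]] by (auto intro!: continuous_at_imp_continuous_on)
    show "(branch_sigma L has_derivative (*) (branch_sigma' L ?p)) (at ?p)"
      using DERIV_branch_sigma[OF assms(1) p(1,2)] by (simp add: has_field_derivative_def)
  qed (use assms p pos in \<open>auto simp: fun_eq_iff\<close>)
  then show ?thesis
    by (simp add: has_field_derivative_def p(3))
qed

section \<open>The second coordinate and the points of the curve\<close>

lemma branch_eta_pos: "0 < c \<Longrightarrow> 0 < L \<Longrightarrow> 0 < p \<Longrightarrow> p < 1 \<Longrightarrow> 0 < branch_eta c L p"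
  using complete_K_pos[of p] by (simp add: branch_eta_def)

text \<open>The derivative of \<open>sqrt (1 - p) * K\<close> simplifies to
  \<open>(E - K) / (2 p sqrt (1 - p))\<close>, which is negative because \<open>E < K\<close>: the
  decay of the root outweighs the growth of \<open>K\<close>.\<close>

lemma branch_eta_strict_antimono:
  assumes c: "0 < c" "0 < L" and pq: "0 < p" "p < q" "q < 1"
  shows "branch_eta c L q < branch_eta c L p"
proof -
  have "sqrt (1 - q) * complete_K q < sqrt (1 - p) * complete_K p"
  proof (rule DERIV_neg_imp_decreasing[where f="\<lambda>p. sqrt (1 - p) * complete_K p", OF pq(2)])
    fix x assume "p \<le> x" "x \<le> q"
    then have x: "0 < x" "x < 1" using pq by auto
    define r where "r = sqrt (1 - x)"
    have r: "0 < r" "1 - x = r\<^sup>2" using x by (auto simp: r_def)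
    have "((\<lambda>p. sqrt (1 - p) * complete_K p) has_real_derivative
        (inverse r / 2 * (0 - 1)) * complete_K x
        + (complete_E x - (1 - x) * complete_K x) / (2 * x * (1 - x)) * r) (at x)"
      unfolding r_def using x
      by (intro DERIV_mult DERIV_chain2[OF DERIV_real_sqrt] DERIV_complete_K DERIV_diff DERIV_const DERIV_ident) auto
    also have "(inverse r / 2 * (0 - 1)) * complete_K x
        + (complete_E x - (1 - x) * complete_K x) / (2 * x * (1 - x)) * r
        = (complete_E x - (r\<^sup>2 + x) * complete_K x) / (2 * x * r)"
      unfolding r(2) using r(1) x(1) by (simp add: divide_simps) (simp add: algebra_simps power2_eq_square)
    also have "r\<^sup>2 + x = 1" using r(2) by simp
    finally show "\<exists>y. ((\<lambda>p. sqrt (1 - p) * complete_K p) has_real_derivative y) (at x) \<and> y < 0"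
      using complete_E_less_K[OF x] r(1) x(1) by (intro exI conjI) (auto simp: divide_less_0_iff)
  qed
  then have "4 * sqrt c / L * (sqrt (1 - q) * complete_K q) < 4 * sqrt c / L * (sqrt (1 - p) * complete_K p)"
    using c by (intro mult_strict_left_mono) auto
  then show ?thesis by (simp add: branch_eta_def mult.assoc)
qed

lemma branch_point_modulus:
  assumes c: "0 < c" "0 < L" and p: "0 < p" "p < 1"
  defines "\<sigma> \<equiv> branch_sigma L p" and "\<eta> \<equiv> branch_eta c L p"
  shows "modulus_sq c \<sigma> \<eta> = p" "modulus c \<sigma> \<eta> = sqrt p" "eta1 c \<sigma> \<eta> = 4 * sqrt c * complete_K p / L"
    "period_T c \<sigma> \<eta> = L" "\<eta> < sqrt (2 * c * \<sigma>)"
proof -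
  define K where "K = complete_K p"
  \<comment> \<open>\<open>D\<close> is the square of \<open>eta1\<close> prescribed by the period.
    In terms of it \<open>\<eta>^2 = (1 - p) D\<close> and \<open>4 c \<sigma> = (2 - p) D\<close>,
    so it cancels from the squared modulus.\<close>
  define D where "D = 16 * c * K\<^sup>2 / L\<^sup>2"
  have K: "0 < K" using complete_K_pos[of p] p by (simp add: K_def)
  have D: "0 < D" using K c by (simp add: D_def)
  have \<eta>: "\<eta>\<^sup>2 = (1 - p) * D"
    using c p by (simp add: \<eta>_def branch_eta_def D_def K_def power_mult_distrib power_divide)
  have \<sigma>: "4 * c * \<sigma> = (2 - p) * D"
    by (simp add: \<sigma>_def branch_sigma_def D_def K_def)
  have diff: "4 * c * \<sigma> - \<eta>\<^sup>2 = D" "4 * c * \<sigma> - 2 * \<eta>\<^sup>2 = p * D"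
    unfolding \<eta> \<sigma> by (simp_all add: algebra_simps)
  show m: "modulus_sq c \<sigma> \<eta> = p"
    unfolding modulus_sq_def diff using D by simp
  then show k: "modulus c \<sigma> \<eta> = sqrt p" by (simp add: modulus_def)
  have sD: "sqrt D = 4 * sqrt c * K / L"
    using K c by (simp add: D_def real_sqrt_mult real_sqrt_divide)
  then show "eta1 c \<sigma> \<eta> = 4 * sqrt c * complete_K p / L"
    unfolding eta1_def diff by (simp add: K_def)
  have "ellip_K (sqrt p) = K"
    using ellip_K_eq[of "sqrt p"] p by (simp add: K_def)
  then show "period_T c \<sigma> \<eta> = L"
    unfolding period_T_def diff k sD using K c by simp
  show "\<eta> < sqrt (2 * c * \<sigma>)"
    using diff(2) mult_pos_pos[OF p(1) D] by (intro real_less_rsqrt) linarith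
qed

text \<open>The squared modulus \<open>p\<close> fixes the ratio of \<open>\<eta>^2\<close> to
  \<open>D = 4 c \<sigma> - \<eta>^2\<close>, and the period equation then fixes \<open>D\<close>
  through \<open>K\<close>. So \<open>p\<close> determines \<sigma> and \<open>\<eta>^2\<close>, and
  the sign of \<eta> is given.\<close>

lemma branch_point_unique:
  assumes c: "0 < c" "0 < L" and \<eta>: "0 < \<eta>"
    and m: "modulus_sq c \<sigma> \<eta> \<in> {0<..<1}" and T: "period_T c \<sigma> \<eta> = L"
  shows "2 * pi\<^sup>2 / L\<^sup>2 < \<sigma>" "\<eta> = branch_eta c L (branch_p L \<sigma>)"
proof -
  define p where "p = modulus_sq c \<sigma> \<eta>"
  define D where "D = 4 * c * \<sigma> - \<eta>\<^sup>2"
  define K where "K = complete_K p"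
  have p: "0 < p" "p < 1" using m by (auto simp: p_def)
  have K: "0 < K" using complete_K_pos[of p] p by (simp add: K_def)
  have pD: "p = (D - \<eta>\<^sup>2) / D" by (simp add: p_def D_def modulus_sq_def)
  have "D \<noteq> 0" using pD p by auto
  then have \<eta>2: "\<eta>\<^sup>2 = (1 - p) * D" using pD by (simp add: field_simps)
  \<comment> \<open>Only for positive \<open>D\<close> is \<open>sqrt D\<close> a genuine root, so
    that the period equation can be squared to recover \<open>D\<close>.\<close>
  have D: "0 < D"
  proof -
    have "0 < (1 - p) * D" unfolding \<eta>2[symmetric] using \<eta> by simp
    then show ?thesis using p by (simp add: zero_less_mult_iff)
  qed
  have "ellip_K (modulus c \<sigma> \<eta>) = K"
    using ellip_K_eq[of "sqrt p"] p by (simp add: K_def modulus_def p_def[symmetric])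
  then have "4 * sqrt c / sqrt D * K = L"
    using T by (simp add: period_T_def D_def)
  then have sD: "sqrt D = 4 * sqrt c * K / L"
    using D c(2) by (simp add: field_simps)
  then have "D = (4 * sqrt c * K / L)\<^sup>2"
    using D by (metis less_imp_le real_sqrt_pow2)
  then have D_eq: "D = 16 * c * K\<^sup>2 / L\<^sup>2"
    using c by (simp add: power_mult_distrib power_divide)
  have "4 * c * \<sigma> = D + \<eta>\<^sup>2" by (simp add: D_def)
  also have "\<dots> = (2 - p) * D" unfolding \<eta>2 by (simp add: algebra_simps)
  finally have "4 * c * \<sigma> = 4 * c * branch_sigma L p"
    by (simp add: D_eq branch_sigma_def K_def mult_ac)
  then have \<sigma>: "\<sigma> = branch_sigma L p" using c by simp
  then show "2 * pi\<^sup>2 / L\<^sup>2 < \<sigma>" using branch_sigma_gt[OF c(2) p] by simp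
  have "\<eta> = sqrt (\<eta>\<^sup>2)" using \<eta> by simp
  also have "\<dots> = sqrt (1 - p) * (4 * sqrt c * K / L)"
    unfolding \<eta>2 real_sqrt_mult sD ..
  finally show "\<eta> = branch_eta c L (branch_p L \<sigma>)"
    using c p by (simp add: \<sigma> branch_eta_def K_def)
qed

lemma modulus_sq_in_unit_interval:
  assumes "0 < c" "\<eta> \<in> {0<..<sqrt (2 * c * \<sigma>)}"
  shows "modulus_sq c \<sigma> \<eta> \<in> {0<..<1}"
proof -
  have "0 \<le> 2 * c * \<sigma>"
    using assms by (auto dest: order.strict_trans simp: real_sqrt_gt_0_iff intro: less_imp_le)
  then have "\<eta>\<^sup>2 < 2 * c * \<sigma>" "0 < \<eta>\<^sup>2"
    using assms(2) real_less_lsqrt[of "sqrt \<eta>"] by (auto dest: power_strict_mono[of \<eta> "sqrt (2 * c * \<sigma>)" 2])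
  then have "0 < 4 * c * \<sigma> - 2 * \<eta>\<^sup>2" "4 * c * \<sigma> - 2 * \<eta>\<^sup>2 < 4 * c * \<sigma> - \<eta>\<^sup>2"
    by linarith+
  moreover have "0 < a / b" "a / b < 1" if "0 < a" "a < b" for a b :: real
    using that by simp_all
  ultimately show ?thesis
    unfolding modulus_sq_def greaterThanLessThan_iff by blast
qed

lemma modulus_sq_imp_nonzero:
  assumes "modulus_sq c \<sigma> \<eta> \<in> {0<..<1}"
  shows "\<eta> \<noteq> 0"
proof
  assume "\<eta> = 0"
  then show False using assms by (cases "c * \<sigma> = 0") (auto simp: modulus_sq_def)
qed

section \<open>Smoothness of the waves\<close>

lemma has_derivative_ell_am':
  assumes "0 < p" "p < 1"
  shows "((\<lambda>(p, u). ell_am p u) has_derivative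
      (\<lambda>(dp, du). - ell_delta p (ell_am p u) * ell_Fp p (ell_am p u) * dp + ell_delta p (ell_am p u) * du))
      (at (p, u))"
  using has_derivative_ell_am[OF assms, of u] by (simp add: algebra_simps case_prod_unfold)

text \<open>\<open>wave_arg\<close> rescales \<open>x\<close> so that \<open>dn\<close>, which has period \<open>2 K\<close>, gets period \<open>L\<close>.\<close>

definition wave_arg :: "real \<Rightarrow> real \<Rightarrow> real \<Rightarrow> real" where
  "wave_arg L \<sigma> x = 2 * complete_K (branch_p L \<sigma>) / L * x"

definition wave_am :: "real \<Rightarrow> real \<Rightarrow> real \<Rightarrow> real" where
  "wave_am L \<sigma> x = ell_am (branch_p L \<sigma>) (wave_arg L \<sigma> x)"

text \<open>The system closes because \<open>ell_F\<close> along the amplitude is just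
  \<open>wave_arg\<close>, which is elementary in \<open>K\<close> and \<open>x\<close>. Hence
  differentiating the amplitude in \<sigma> introduces only \<open>ell_E\<close> along it, and
  differentiating that introduces nothing new.\<close>

definition wave_generators :: "real \<Rightarrow> (real \<Rightarrow> real \<Rightarrow> real) set" where
  "wave_generators L = {\<lambda>\<sigma> x. x, \<lambda>\<sigma> x. branch_p L \<sigma>, \<lambda>\<sigma> x. complete_K (branch_p L \<sigma>),
     \<lambda>\<sigma> x. complete_E (branch_p L \<sigma>), wave_am L, \<lambda>\<sigma> x. ell_E (branch_p L \<sigma>) (wave_am L \<sigma> x)}"

lemma closed_under_partials_wave:
  assumes L: "0 < L"
  defines "J \<equiv> {2 * pi\<^sup>2 / L\<^sup>2<..}"
  shows "closed_under_partials J (elem_functions J (wave_generators L))"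
proof (rule elem_functions_closed_under_partials)
  define E where "E = elem_functions J (wave_generators L)"
  let ?P = "branch_p L"
  let ?K = "\<lambda>\<sigma>. complete_K (?P \<sigma>)" and ?E = "\<lambda>\<sigma>. complete_E (?P \<sigma>)"
  let ?eps = "\<lambda>\<sigma> x. ell_E (?P \<sigma>) (wave_am L \<sigma> x)"
  define V where "V = (\<lambda>\<sigma>. inverse (branch_sigma' L (?P \<sigma>)))"
  have gens: "(\<lambda>\<sigma> x. x) \<in> E" "(\<lambda>\<sigma> x. ?P \<sigma>) \<in> E" "(\<lambda>\<sigma> x. ?K \<sigma>) \<in> E" "(\<lambda>\<sigma> x. ?E \<sigma>) \<in> E"
      "(\<lambda>\<sigma> x. wave_am L \<sigma> x) \<in> E" "(\<lambda>\<sigma> x. ?eps \<sigma> x) \<in> E"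
    unfolding E_def by (auto intro!: elem_functions.gen simp: wave_generators_def)
  note E_intros = elem_functions_intros[where J=J and G="wave_generators L", folded E_def]
  have p: "0 < ?P \<sigma>" "?P \<sigma> < 1" if "\<sigma> \<in> J" for \<sigma>
    using branch_p[OF L] that by (auto simp: J_def)
  have W: "0 < branch_sigma' L (?P \<sigma>)" if "\<sigma> \<in> J" for \<sigma>
    by (rule branch_sigma'_pos[OF L p[OF that]])
  have nz: "?P \<sigma> \<noteq> 0" "1 - ?P \<sigma> \<noteq> 0" "L \<noteq> 0" if "\<sigma> \<in> J" for \<sigma>
    using p[OF that] L by auto
  \<comment> \<open>The derivative of the inverse function \<open>branch_p\<close> is elementary
    because \<open>branch_sigma'\<close> is a nonvanishing expression in \<open>p\<close>,
    \<open>K\<close> and \<open>E\<close>.\<close>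
  have V: "(\<lambda>\<sigma> x. V \<sigma>) \<in> E"
  proof -
    have "(\<lambda>\<sigma> x. branch_sigma' L (?P \<sigma>)) \<in> E"
      unfolding branch_sigma'_def by (intro E_intros gens) (use nz in auto)
    from E_intros(9)[OF E_intros(1)[of 1] this] show ?thesis
      using W by (force simp: V_def inverse_eq_divide)
  qed
  define Ks where "Ks = (\<lambda>\<sigma>. (?E \<sigma> - (1 - ?P \<sigma>) * ?K \<sigma>) / (2 * ?P \<sigma> * (1 - ?P \<sigma>)) * V \<sigma>)"
  have Ks: "(\<lambda>\<sigma> x. Ks \<sigma>) \<in> E"
    unfolding Ks_def by (intro E_intros gens V) (use nz in auto)
  define us where "us = (\<lambda>\<sigma> x. 2 * Ks \<sigma> / L * x)"
  have us: "(\<lambda>\<sigma> x. us \<sigma> x) \<in> E"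
    unfolding us_def by (intro E_intros gens Ks) (use nz in auto)
  have u: "(\<lambda>\<sigma> x. wave_arg L \<sigma> x) \<in> E"
    unfolding wave_arg_def by (intro E_intros gens) (use nz in auto)
  have dn: "(\<lambda>\<sigma> x. ell_delta (?P \<sigma>) (wave_am L \<sigma> x)) \<in> E"
    unfolding ell_delta_def by (intro E_intros gens) (use p delta_sq_pos in auto)
  define Fp where "Fp = (\<lambda>\<sigma> x. (?eps \<sigma> x - (1 - ?P \<sigma>) * wave_arg L \<sigma> x) / (2 * ?P \<sigma> * (1 - ?P \<sigma>))
     - sin (wave_am L \<sigma> x) * cos (wave_am L \<sigma> x) / (2 * (1 - ?P \<sigma>) * ell_delta (?P \<sigma>) (wave_am L \<sigma> x)))"
  have "ell_delta (?P \<sigma>) (wave_am L \<sigma> x) \<noteq> 0" if "\<sigma> \<in> J" for \<sigma> x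
    using ell_delta_pos[OF p(2)[OF that], of "wave_am L \<sigma> x"] by simp
  then have Fp_mem: "(\<lambda>\<sigma> x. Fp \<sigma> x) \<in> E"
    unfolding Fp_def by (intro E_intros gens u dn) (use nz in auto)
  have F_am: "ell_F (?P \<sigma>) (wave_am L \<sigma> x) = wave_arg L \<sigma> x" if "\<sigma> \<in> J" for \<sigma> x
    using p[OF that] by (simp add: wave_am_def)
  have Fp: "ell_Fp (?P \<sigma>) (wave_am L \<sigma> x) = Fp \<sigma> x" if "\<sigma> \<in> J" for \<sigma> x
    unfolding ell_Fp_def Fp_def F_am[OF that] ..
  define as where "as = (\<lambda>\<sigma> x. - ell_delta (?P \<sigma>) (wave_am L \<sigma> x) * Fp \<sigma> x * V \<sigma>
      + ell_delta (?P \<sigma>) (wave_am L \<sigma> x) * us \<sigma> x)"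
  have as: "(\<lambda>\<sigma> x. as \<sigma> x) \<in> E"
    unfolding as_def by (intro E_intros dn Fp_mem V us)
  define ax where "ax = (\<lambda>\<sigma> x. ell_delta (?P \<sigma>) (wave_am L \<sigma> x) * (2 * ?K \<sigma> / L))"
  have ax: "(\<lambda>\<sigma> x. ax \<sigma> x) \<in> E"
    unfolding ax_def by (intro E_intros gens dn) (use nz in auto)
  have P_s: "(?P has_real_derivative V \<sigma>) (at \<sigma>)" if "\<sigma> \<in> J" for \<sigma>
    using DERIV_branch_p[OF L] that by (simp add: V_def J_def)
  have K_s: "((\<lambda>\<sigma>. ?K \<sigma>) has_real_derivative Ks \<sigma>) (at \<sigma>)" if "\<sigma> \<in> J" for \<sigma>
    unfolding Ks_def by (rule DERIV_chain2[OF DERIV_complete_K[OF p[OF that]] P_s[OF that]])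
  have E_s: "((\<lambda>\<sigma>. ?E \<sigma>) has_real_derivative (?E \<sigma> - ?K \<sigma>) / (2 * ?P \<sigma>) * V \<sigma>) (at \<sigma>)"
    if "\<sigma> \<in> J" for \<sigma>
    by (rule DERIV_chain2[OF DERIV_complete_E[OF p[OF that]] P_s[OF that]])
  have u_s: "((\<lambda>\<sigma>. wave_arg L \<sigma> x) has_real_derivative us \<sigma> x) (at \<sigma>)" if "\<sigma> \<in> J" for \<sigma> x
    unfolding wave_arg_def us_def
    by (intro DERIV_cmult_right DERIV_cdivide DERIV_cmult K_s that)
  have u_x: "(wave_arg L \<sigma> has_real_derivative 2 * ?K \<sigma> / L) (at x)" for \<sigma> x
    unfolding wave_arg_def[abs_def] using DERIV_cmult_Id by blast
  have a_s: "((\<lambda>\<sigma>. wave_am L \<sigma> x) has_real_derivative as \<sigma> x) (at \<sigma>)" if "\<sigma> \<in> J" for \<sigma> x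
    using DERIV_joint_chain[where P="?P" and U="\<lambda>\<sigma>. wave_arg L \<sigma> x",
        OF has_derivative_ell_am'[OF p[OF that]] P_s[OF that] u_s[OF that]]
    by (simp add: wave_am_def[symmetric] Fp[OF that] as_def)
  have a_x: "(wave_am L \<sigma> has_real_derivative ax \<sigma> x) (at x)" if "\<sigma> \<in> J" for \<sigma> x
    using DERIV_joint_chain[where P="\<lambda>x. ?P \<sigma>" and U="wave_arg L \<sigma>",
        OF has_derivative_ell_am'[OF p[OF that]] DERIV_const u_x]
    by (simp add: wave_am_def[symmetric] wave_am_def[abs_def, symmetric] ax_def)
  have eps_s: "((\<lambda>\<sigma>. ?eps \<sigma> x) has_real_derivative (?eps \<sigma> x - wave_arg L \<sigma> x) / (2 * ?P \<sigma>) * V \<sigma>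
      + ell_delta (?P \<sigma>) (wave_am L \<sigma> x) * as \<sigma> x) (at \<sigma>)" if "\<sigma> \<in> J" for \<sigma> x
    using DERIV_joint_chain[where P="?P" and U="\<lambda>\<sigma>. wave_am L \<sigma> x",
        OF has_derivative_ell_E[OF p[OF that]] P_s[OF that] a_s[OF that]]
    by (simp add: F_am[OF that])
  have eps_x: "((\<lambda>x. ?eps \<sigma> x) has_real_derivative ell_delta (?P \<sigma>) (wave_am L \<sigma> x) * ax \<sigma> x) (at x)"
    if "\<sigma> \<in> J" for \<sigma> x
    by (rule DERIV_chain2[OF DERIV_ell_E_phi a_x[OF that]])
  have cont_P: "continuous_on J ?P"
    using DERIV_isCont[OF P_s] by (auto intro: continuous_at_imp_continuous_on)
  have cont_K: "continuous_on J ?K" and cont_E: "continuous_on J ?E"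
    using DERIV_isCont[OF K_s] DERIV_isCont[OF E_s] by (auto intro: continuous_at_imp_continuous_on)
  have fst_J: "continuous_on (J \<times> (UNIV :: real set)) (\<lambda>z. h (fst z))" if "continuous_on J h" for h :: "real \<Rightarrow> real"
    by (rule continuous_on_compose2[OF that]) (auto intro: continuous_intros)
  have pair: "continuous_on (J \<times> UNIV) (\<lambda>z. f (?P (fst z)) (U (fst z) (snd z)))"
    if "continuous_on (J \<times> UNIV) (\<lambda>z. U (fst z) (snd z))"
      and "\<And>p u. 0 < p \<Longrightarrow> p < 1 \<Longrightarrow> \<exists>D. ((\<lambda>(p, u). f p u) has_derivative D) (at (p, u))"
    for f U :: "real \<Rightarrow> real \<Rightarrow> real"
  proof -
    have "continuous_on ({0<..<1} \<times> UNIV) (\<lambda>(p, u). f p u)"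
      using that(2) has_derivative_continuous by (fastforce intro!: continuous_at_imp_continuous_on)
    then have "continuous_on (J \<times> UNIV) (\<lambda>z. (\<lambda>(p, u). f p u) (?P (fst z), U (fst z) (snd z)))"
      by (rule continuous_on_compose2) (auto intro!: continuous_on_Pair fst_J cont_P that(1) simp: p)
    then show ?thesis by simp
  qed
  have cont_u: "continuous_on (J \<times> UNIV) (\<lambda>z. wave_arg L (fst z) (snd z))"
    unfolding wave_arg_def by (intro continuous_intros fst_J cont_K) (use L in auto)
  have cont_a: "continuous_on (J \<times> UNIV) (\<lambda>z. wave_am L (fst z) (snd z))"
    unfolding wave_am_def by (rule pair[OF cont_u]) (use has_derivative_ell_am' in blast)
  have cont_eps: "continuous_on (J \<times> UNIV) (\<lambda>z. ?eps (fst z) (snd z))"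
    by (rule pair[OF cont_a]) (use has_derivative_ell_E in blast)
  show "continuous_on (J \<times> UNIV) (\<lambda>(s, x). g s x) \<and>
     (\<exists>h\<in>elem_functions J (wave_generators L). \<forall>s\<in>J. \<forall>x. ((\<lambda>s. g s x) has_real_derivative h s x) (at s)) \<and>
     (\<exists>h\<in>elem_functions J (wave_generators L). \<forall>s\<in>J. \<forall>x. (g s has_real_derivative h s x) (at x))"
    if "g \<in> wave_generators L" for g
  proof -
    have witness: "continuous_on (J \<times> UNIV) (\<lambda>(s, x). g s x) \<and>
       (\<exists>h\<in>elem_functions J (wave_generators L). \<forall>s\<in>J. \<forall>x. ((\<lambda>s. g s x) has_real_derivative h s x) (at s)) \<and>
       (\<exists>h\<in>elem_functions J (wave_generators L). \<forall>s\<in>J. \<forall>x. (g s has_real_derivative h s x) (at x))"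
      if "continuous_on (J \<times> UNIV) (\<lambda>z. g (fst z) (snd z))"
        and "(\<lambda>s x. gs s x) \<in> E" "(\<lambda>s x. gx s x) \<in> E"
        and "\<And>s x. s \<in> J \<Longrightarrow> ((\<lambda>s. g s x) has_real_derivative gs s x) (at s)"
        and "\<And>s x. s \<in> J \<Longrightarrow> ((\<lambda>x. g s x) has_real_derivative gx s x) (at x)" for g gs gx
      unfolding E_def[symmetric] case_prod_unfold using that by blast
    have zero: "(\<lambda>\<sigma> x. 0) \<in> E" and one: "(\<lambda>\<sigma> x. 1) \<in> E"
      by (rule E_intros(1))+
    have E_mem: "(\<lambda>\<sigma> x. (?E \<sigma> - ?K \<sigma>) / (2 * ?P \<sigma>) * V \<sigma>) \<in> E"
      by (intro E_intros gens V) (use nz in auto)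
    have eps_mem: "(\<lambda>\<sigma> x. (?eps \<sigma> x - wave_arg L \<sigma> x) / (2 * ?P \<sigma>) * V \<sigma>
      + ell_delta (?P \<sigma>) (wave_am L \<sigma> x) * as \<sigma> x) \<in> E" "(\<lambda>\<sigma> x. ell_delta (?P \<sigma>) (wave_am L \<sigma> x) * ax \<sigma> x) \<in> E"
      by (intro E_intros gens V u dn as ax; use nz in auto)+
    from that consider "g = (\<lambda>\<sigma> x. x)" | "g = (\<lambda>\<sigma> x. ?P \<sigma>)" | "g = (\<lambda>\<sigma> x. ?K \<sigma>)"
      | "g = (\<lambda>\<sigma> x. ?E \<sigma>)" | "g = wave_am L" | "g = ?eps"
      unfolding wave_generators_def by blast
    then show ?thesis
    proof cases
      case 1
      show ?thesis
        unfolding 1 by (rule witness[OF _ zero one]) (auto intro!: continuous_intros)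
    next
      case 2
      show ?thesis
        unfolding 2 by (rule witness[OF fst_J[OF cont_P] V zero P_s]) auto
    next
      case 3
      show ?thesis
        unfolding 3 by (rule witness[OF fst_J[OF cont_K] Ks zero K_s]) auto
    next
      case 4
      show ?thesis
        unfolding 4 by (rule witness[OF fst_J[OF cont_E] E_mem zero E_s]) auto
    next
      case 5
      show ?thesis
        unfolding 5 by (rule witness[OF cont_a as ax a_s a_x])
    next
      case 6
      show ?thesis
        unfolding 6 by (rule witness[OF cont_eps eps_mem eps_s eps_x])
    qed
  qed
qed

text \<open>This is \<open>phi0\<close> along the branch, rewritten in the generators so that it is
  visibly an elementary expression in them.\<close>

definition wave_family :: "real \<Rightarrow> real \<Rightarrow> real \<Rightarrow> real \<Rightarrow> real" where
  "wave_family c L \<sigma> x = 4 * sqrt c * complete_K (branch_p L \<sigma>) / L * ell_delta (branch_p L \<sigma>) (wave_am L \<sigma> x)"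

definition branch_Lambda :: "real \<Rightarrow> real \<Rightarrow> real \<Rightarrow> real" where
  "branch_Lambda c L \<sigma> = branch_eta c L (branch_p L \<sigma>)"

lemma smooth_family_wave:
  assumes L: "0 < L"
  shows "\<exists>D. smooth_family {2 * pi\<^sup>2 / L\<^sup>2<..} D \<and> D 0 0 = wave_family c L"
    and "\<exists>D. smooth_family {2 * pi\<^sup>2 / L\<^sup>2<..} D \<and> D 0 0 = (\<lambda>\<sigma> x. branch_Lambda c L \<sigma>)"
proof -
  let ?J = "{2 * pi\<^sup>2 / L\<^sup>2<..}"
  let ?E = "elem_functions ?J (wave_generators L)"
  have gens: "(\<lambda>\<sigma> x. branch_p L \<sigma>) \<in> ?E" "(\<lambda>\<sigma> x. complete_K (branch_p L \<sigma>)) \<in> ?E"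
      "(\<lambda>\<sigma> x. wave_am L \<sigma> x) \<in> ?E"
    by (auto intro!: elem_functions.gen simp: wave_generators_def)
  have p: "0 < branch_p L \<sigma>" "branch_p L \<sigma> < 1" if "\<sigma> \<in> ?J" for \<sigma>
    using branch_p[OF L] that by auto
  have "(\<lambda>\<sigma> x. wave_family c L \<sigma> x) \<in> ?E"
    unfolding wave_family_def ell_delta_def
    by (intro elem_functions_intros gens) (use L delta_sq_pos[OF p(2)] in auto)
  then show "\<exists>D. smooth_family ?J D \<and> D 0 0 = wave_family c L"
    by (intro closed_under_partials_smooth_family[OF _ closed_under_partials_wave[OF L]]) auto
  have "(\<lambda>\<sigma> x. branch_Lambda c L \<sigma>) \<in> ?E"
    unfolding branch_Lambda_def branch_eta_def
    by (intro elem_functions_intros gens) (use L p in auto)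
  then show "\<exists>D. smooth_family ?J D \<and> D 0 0 = (\<lambda>\<sigma> x. branch_Lambda c L \<sigma>)"
    by (intro closed_under_partials_smooth_family[OF _ closed_under_partials_wave[OF L]]) auto
qed

section \<open>The waves along the branch\<close>

lemma DERIV_ell_am:
  assumes "0 < p" "p < 1"
  shows "(ell_am p has_real_derivative ell_delta p (ell_am p u)) (at u)"
  using DERIV_joint_chain[where P="\<lambda>u. p" and U="\<lambda>u. u",
      OF has_derivative_ell_am'[OF assms] DERIV_const DERIV_ident] by simp

text \<open>These are the classical relations \<open>dn' = - p sn cn\<close> and
  \<open>dn'' = (2 - p) dn - 2 dn^3\<close>.\<close>

lemma ell_dn_second_derivative:
  assumes p: "0 < p" "p < 1"
  defines "dn \<equiv> \<lambda>u. ell_delta p (ell_am p u)"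
  shows "(dn has_real_derivative - p * sin (ell_am p u) * cos (ell_am p u)) (at u)"
    and "((\<lambda>u. - p * sin (ell_am p u) * cos (ell_am p u)) has_real_derivative
           dn u * (2 - p - 2 * (dn u)\<^sup>2)) (at u)"
proof -
  show "(dn has_real_derivative - p * sin (ell_am p u) * cos (ell_am p u)) (at u)"
    using DERIV_chain2[OF DERIV_ell_delta_phi[OF p(2)] DERIV_ell_am[OF p, of u]]
      ell_delta_pos[OF p(2), of "ell_am p u"]
    by (simp add: dn_def)
  have "((\<lambda>u. - p * sin (ell_am p u) * cos (ell_am p u)) has_real_derivative
      - p * (cos (ell_am p u) * dn u) * cos (ell_am p u)
      + (- sin (ell_am p u) * dn u) * (- p * sin (ell_am p u))) (at u)"
    unfolding dn_def
    by (intro DERIV_mult DERIV_cmult DERIV_chain2[OF DERIV_sin DERIV_ell_am[OF p]]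
        DERIV_chain2[OF DERIV_cos DERIV_ell_am[OF p]])
  also have "- p * (cos (ell_am p u) * dn u) * cos (ell_am p u)
      + (- sin (ell_am p u) * dn u) * (- p * sin (ell_am p u))
      = dn u * (- p * (cos (ell_am p u))\<^sup>2 + p * (sin (ell_am p u))\<^sup>2)"
    by (simp add: algebra_simps power2_eq_square)
  also have "- p * (cos (ell_am p u))\<^sup>2 + p * (sin (ell_am p u))\<^sup>2 = 2 - p - 2 * (dn u)\<^sup>2"
    unfolding dn_def ell_delta_sq[OF p(2)] cos_squared_eq by (simp add: algebra_simps)
  finally show "((\<lambda>u. - p * sin (ell_am p u) * cos (ell_am p u)) has_real_derivative
           dn u * (2 - p - 2 * (dn u)\<^sup>2)) (at u)" .
qed

lemma psi0_eq_phi0: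
  "0 < c \<Longrightarrow> psi0 c \<sigma> \<eta> \<xi> = - (1 / (2 * c)) * (phi0 c \<sigma> \<eta> \<xi>)\<^sup>2"
  by (simp add: psi0_def phi0_def power_mult_distrib)

lemma branch_Lambda_point:
  assumes c: "0 < c" and L: "0 < L" and \<sigma>: "2 * pi\<^sup>2 / L\<^sup>2 < \<sigma>"
  shows "modulus_sq c \<sigma> (branch_Lambda c L \<sigma>) = branch_p L \<sigma>"
    "modulus c \<sigma> (branch_Lambda c L \<sigma>) = sqrt (branch_p L \<sigma>)"
    "eta1 c \<sigma> (branch_Lambda c L \<sigma>) = 4 * sqrt c * complete_K (branch_p L \<sigma>) / L"
    "period_T c \<sigma> (branch_Lambda c L \<sigma>) = L"
    "branch_Lambda c L \<sigma> \<in> {0<..<sqrt (2 * c * \<sigma>)}"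
  using branch_point_modulus[OF c L branch_p(1,2)[OF L \<sigma>]] branch_eta_pos[OF c L branch_p(1,2)[OF L \<sigma>]]
  by (simp_all add: branch_p(3)[OF L \<sigma>] branch_Lambda_def)

lemma phi0_eq_wave:
  assumes c: "0 < c" and L: "0 < L" and \<sigma>: "2 * pi\<^sup>2 / L\<^sup>2 < \<sigma>"
  shows "phi0 c \<sigma> (branch_Lambda c L \<sigma>) = wave_family c L \<sigma>"
proof
  fix \<xi>
  have "4 * sqrt c * complete_K (branch_p L \<sigma>) / L / (2 * sqrt c) * \<xi> = wave_arg L \<sigma> \<xi>"
    using c by (simp add: wave_arg_def)
  then show "phi0 c \<sigma> (branch_Lambda c L \<sigma>) \<xi> = wave_family c L \<sigma> \<xi>"
    using branch_p[OF L \<sigma>]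
    by (simp only: phi0_def branch_Lambda_point[OF c L \<sigma>] jacobi_dn_eq wave_family_def wave_am_def
        real_sqrt_pow2 less_imp_le)
qed

text \<open>The outer function \<open>g\<close> treats both waves at once: the identity gives
  \<open>phi0\<close>, and a negative multiple of the square gives \<open>psi0\<close>. The wave is
  positive, so injectivity on the nonnegative reals suffices.\<close>

lemma fundamental_period_wave:
  assumes c: "0 < c" and L: "0 < L" and \<sigma>: "2 * pi\<^sup>2 / L\<^sup>2 < \<sigma>"
    and g: "inj_on g {0..}"
  shows "fundamental_period (\<lambda>x. g (wave_family c L \<sigma> x)) L"
proof -
  let ?p = "branch_p L \<sigma>"
  note p = branch_p(1,2)[OF L \<sigma>]
  have K: "0 < complete_K ?p" using complete_K_pos p by simp
  define b where "b = 2 * complete_K ?p / L"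
  define \<eta> where "\<eta> = 4 * sqrt c * complete_K ?p / L"
  have b: "0 < b" and \<eta>: "0 < \<eta>" using K L c by (auto simp: b_def \<eta>_def)
  have "fundamental_period (\<lambda>x. (\<lambda>y. g (\<eta> * y)) (ell_delta ?p (ell_am ?p (b * x)))) (2 * complete_K ?p / b)"
  proof (rule fundamental_period_rescale[OF fundamental_period_ell_delta_am[OF p] b])
    show "inj_on (\<lambda>y. g (\<eta> * y)) (range (\<lambda>u. ell_delta ?p (ell_am ?p u)))"
      using \<eta> ell_delta_pos[OF p(2)] by (intro inj_onI) (auto dest!: inj_onD[OF g] simp: less_imp_le)
  qed
  then show ?thesis
    using K L by (simp add: wave_family_def wave_am_def wave_arg_def b_def \<eta>_def)
qed

lemma wave_ode:
  assumes c: "0 < c" and L: "0 < L" and \<sigma>: "2 * pi\<^sup>2 / L\<^sup>2 < \<sigma>"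
  defines "f \<equiv> wave_family c L \<sigma>"
  shows "f field_differentiable (at \<xi>)" "deriv f field_differentiable (at \<xi>)"
    "deriv (deriv f) \<xi> - \<sigma> * f \<xi> = - (1 / (2 * c)) * (f \<xi>)\<^sup>2 * f \<xi>"
proof -
  let ?p = "branch_p L \<sigma>"
  note p = branch_p(1,2)[OF L \<sigma>]
  define b where "b = 2 * complete_K ?p / L"
  define \<eta> where "\<eta> = 4 * sqrt c * complete_K ?p / L"
  define dn where "dn = (\<lambda>u. ell_delta ?p (ell_am ?p u))"
  define dn' where "dn' = (\<lambda>u. - ?p * sin (ell_am ?p u) * cos (ell_am ?p u))"
  have f: "f = (\<lambda>x. \<eta> * dn (b * x))"
    by (simp add: f_def fun_eq_iff wave_family_def wave_am_def wave_arg_def b_def \<eta>_def dn_def)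
  have lin: "((*) b has_real_derivative b) (at x)" for x
    using DERIV_cmult_Id by blast
  have f': "(f has_real_derivative \<eta> * (dn' (b * x) * b)) (at x)" for x
    unfolding f dn_def dn'_def
    by (intro DERIV_cmult DERIV_chain2[OF ell_dn_second_derivative(1)[OF p] lin])
  then have deriv_f: "deriv f = (\<lambda>x. \<eta> * (dn' (b * x) * b))"
    by (auto intro: DERIV_imp_deriv)
  have f'': "(deriv f has_real_derivative
      \<eta> * (dn (b * x) * (2 - ?p - 2 * (dn (b * x))\<^sup>2) * b * b)) (at x)" for x
    unfolding deriv_f dn_def dn'_def
    by (intro DERIV_cmult DERIV_cmult_right DERIV_chain2[OF ell_dn_second_derivative(2)[OF p] lin])
  show "f field_differentiable (at \<xi>)" "deriv f field_differentiable (at \<xi>)"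
    using f' f'' unfolding field_differentiable_def by blast+
  \<comment> \<open>Rescaling the equation of \<open>dn\<close> gives the linear coefficient
    \<open>b^2 (2 - p)\<close> and the cubic coefficient \<open>2 b^2 / \<eta>^2\<close>. The next
    two identities turn these into \<sigma> and \<open>1 / (2 c)\<close>.\<close>
  have \<eta>2: "\<eta>\<^sup>2 = 4 * c * b\<^sup>2"
    using c by (simp add: \<eta>_def b_def power_mult_distrib power_divide)
  have \<sigma>_eq: "\<sigma> = b\<^sup>2 * (2 - ?p)"
    using branch_p(3)[OF L \<sigma>] by (simp add: branch_sigma_def b_def power_mult_distrib power_divide)
  define y where "y = dn (b * \<xi>)"
  have "\<eta> * (y * (2 - ?p - 2 * y\<^sup>2) * b * b) - b\<^sup>2 * (2 - ?p) * (\<eta> * y) = - 2 * b\<^sup>2 * y\<^sup>2 * (\<eta> * y)"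
    by (simp add: algebra_simps power2_eq_square)
  also have "- 2 * b\<^sup>2 * y\<^sup>2 = - (1 / (2 * c)) * (\<eta> * y)\<^sup>2"
    unfolding power_mult_distrib \<eta>2 using c by (simp add: field_simps)
  finally have "\<eta> * (y * (2 - ?p - 2 * y\<^sup>2) * b * b) - b\<^sup>2 * (2 - ?p) * (\<eta> * y)
      = - (1 / (2 * c)) * (\<eta> * y)\<^sup>2 * (\<eta> * y)" .
  then show "deriv (deriv f) \<xi> - \<sigma> * f \<xi> = - (1 / (2 * c)) * (f \<xi>)\<^sup>2 * f \<xi>"
    unfolding DERIV_imp_deriv[OF f''] y_def \<sigma>_eq[symmetric] by (simp add: f)
qed

section \<open>Branches through the given point\<close>

lemma period_branch_Lambda:
  assumes c: "0 < c" and L: "0 < L" and \<sigma>0: "2 * pi\<^sup>2 / L\<^sup>2 < \<sigma>0"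
  shows "period_branch L c \<sigma>0 (branch_Lambda c L \<sigma>0) {2 * pi\<^sup>2 / L\<^sup>2<..} {0<..} (branch_Lambda c L)"
proof -
  let ?J = "{2 * pi\<^sup>2 / L\<^sup>2<..}"
  obtain D where D: "smooth_family ?J D" "D 0 0 = (\<lambda>\<sigma> x. branch_Lambda c L \<sigma>)"
    using smooth_family_wave(2)[OF L] by blast
  have "smooth_on_open ?J (branch_Lambda c L)"
    using smooth_family_smooth_on_open[OF _ D(1)] by (simp add: D(2))
  then show ?thesis
    unfolding period_branch_def
    using branch_Lambda_point[OF c L] branch_p[OF L] by auto
qed

text \<open>On a branch \<open>\<Lambda>\<close> never vanishes, because \<open>\<eta>\<^sub>2 = 0\<close> forces the squared modulus to be \<open>1\<close> (or \<open>0 / 0 = 0\<close>), so it keeps the sign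
  it has at \<open>\<sigma>\<^sub>0\<close>.\<close>

lemma period_branch_eq_Lambda:
  assumes c: "0 < c" and L: "0 < L" and \<eta>0: "0 < \<eta>0"
    and I: "open_interval_around \<sigma>0 I" and br: "period_branch L c \<sigma>0 \<eta>0 I B \<Lambda>" and \<sigma>: "\<sigma> \<in> I"
  shows "2 * pi\<^sup>2 / L\<^sup>2 < \<sigma>" "\<Lambda> \<sigma> = branch_Lambda c L \<sigma>"
proof -
  have m: "modulus_sq c s (\<Lambda> s) \<in> {0<..<1}" "period_T c s (\<Lambda> s) = L" if "s \<in> I" for s
    using br that unfolding period_branch_def by auto
  have "\<Lambda> field_differentiable (at s)" if "s \<in> I" for s
    using br that unfolding period_branch_def smooth_on_open_def by (metis funpow_0)
  then have "continuous_on I \<Lambda>"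
    using field_differentiable_imp_continuous_at by (blast intro: continuous_at_imp_continuous_on)
  moreover have "connected I" "\<sigma>0 \<in> I"
    using I by (auto simp: open_interval_around_def is_interval_connected)
  ultimately have conn: "connected (\<Lambda> ` I)" by (intro connected_continuous_image)
  have "0 < \<Lambda> \<sigma>"
  proof (rule ccontr)
    assume "\<not> 0 < \<Lambda> \<sigma>"
    moreover have "\<Lambda> \<sigma>0 = \<eta>0" using br by (simp add: period_branch_def)
    ultimately have "0 \<in> \<Lambda> ` I"
      using connectedD_interval[OF conn, of "\<Lambda> \<sigma>" "\<Lambda> \<sigma>0" 0] \<sigma> \<open>\<sigma>0 \<in> I\<close> \<eta>0 by auto
    then obtain s where "s \<in> I" "\<Lambda> s = 0" by auto
    then show False using modulus_sq_imp_nonzero[OF m(1)[OF \<open>s \<in> I\<close>]] by simp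
  qed
  from branch_point_unique[OF c L this m[OF \<sigma>]]
  show "2 * pi\<^sup>2 / L\<^sup>2 < \<sigma>" "\<Lambda> \<sigma> = branch_Lambda c L \<sigma>"
    unfolding branch_Lambda_def by simp_all
qed

lemma branch_Lambda_antimono:
  assumes "0 < c" "0 < L" "2 * pi\<^sup>2 / L\<^sup>2 < \<sigma>" "\<sigma> < \<tau>"
  shows "branch_Lambda c L \<tau> < branch_Lambda c L \<sigma>"
  unfolding branch_Lambda_def using assms branch_p[of L \<sigma>] branch_p[of L \<tau>]
  by (intro branch_eta_strict_antimono branch_p_strict_mono) auto

lemma smooth_curve_phi0:
  assumes c: "0 < c" and L: "0 < L" and I: "open I" "I \<subseteq> {2 * pi\<^sup>2 / L\<^sup>2<..}"
    and \<Lambda>: "\<And>\<sigma>. \<sigma> \<in> I \<Longrightarrow> \<Lambda> \<sigma> = branch_Lambda c L \<sigma>"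
  shows "smooth_curve_Hper n L I (\<lambda>\<sigma> \<xi>. complex_of_real (phi0 c \<sigma> (\<Lambda> \<sigma>) \<xi>))"
proof -
  obtain D where D: "smooth_family {2 * pi\<^sup>2 / L\<^sup>2<..} D" "D 0 0 = wave_family c L"
    using smooth_family_wave(1)[OF L] by blast
  have "smooth_curve_Hper n L I (\<lambda>\<sigma> \<xi>. complex_of_real (D 0 0 \<sigma> \<xi>))"
  proof (rule smooth_family_smooth_curve_Hper[OF L I(1) smooth_family_subset[OF D(1) I(2)]])
    show "D 0 0 \<sigma> (x + L) = D 0 0 \<sigma> x" if "\<sigma> \<in> I" for \<sigma> x
      using fundamental_period_wave[OF c L, of \<sigma> "\<lambda>y. y"] that I(2)
      by (auto simp: D(2) fundamental_period_def)
  qed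
  moreover have "wave_family c L \<sigma> = phi0 c \<sigma> (\<Lambda> \<sigma>)" if "\<sigma> \<in> I" for \<sigma>
    using phi0_eq_wave[OF c L, of \<sigma>] \<Lambda>[OF that] that I(2) by auto
  ultimately show ?thesis
    unfolding smooth_curve_Hper_def by (simp add: D(2) cong: ball_cong)
qed

text \<open>Every branch agrees on \<open>I\<close> with \<open>branch_Lambda\<close>, so its waves
  are members of \<open>wave_family\<close> and its squared modulus is \<open>branch_p\<close>; both
  monotonicity claims come from the increase of \<open>branch_p\<close>.\<close>

lemma period_branch_waves:
  assumes c: "0 < c" and L: "0 < L" and \<eta>0: "0 < \<eta>0"
    and I: "open_interval_around \<sigma>0 I" and br: "period_branch L c \<sigma>0 \<eta>0 I B \<Lambda>"
  shows "\<forall>\<sigma>\<in>I.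
            fundamental_period (phi0 c \<sigma> (\<Lambda> \<sigma>)) L \<and>
            fundamental_period (psi0 c \<sigma> (\<Lambda> \<sigma>)) L \<and>
            (\<forall>\<xi>. phi0 c \<sigma> (\<Lambda> \<sigma>) field_differentiable (at \<xi>) \<and>
                 deriv (phi0 c \<sigma> (\<Lambda> \<sigma>)) field_differentiable (at \<xi>) \<and>
                 deriv (deriv (phi0 c \<sigma> (\<Lambda> \<sigma>))) \<xi> - \<sigma> * phi0 c \<sigma> (\<Lambda> \<sigma>) \<xi>
                   = psi0 c \<sigma> (\<Lambda> \<sigma>) \<xi> * phi0 c \<sigma> (\<Lambda> \<sigma>) \<xi> \<and>
                 psi0 c \<sigma> (\<Lambda> \<sigma>) \<xi> = - (1 / (2 * c)) * (phi0 c \<sigma> (\<Lambda> \<sigma>) \<xi>)\<^sup>2)"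
    and "smooth_curve_Hper n L I (\<lambda>\<sigma> \<xi>. complex_of_real (phi0 c \<sigma> (\<Lambda> \<sigma>) \<xi>))"
    and "strict_antimono_on I \<Lambda>"
    and "strict_mono_on I (\<lambda>\<sigma>. modulus c \<sigma> (\<Lambda> \<sigma>))"
proof -
  note \<Lambda> = period_branch_eq_Lambda[OF c L \<eta>0 I br]
  show "strict_antimono_on I \<Lambda>"
    using \<Lambda> branch_Lambda_antimono[OF c L] by (intro monotone_onI) auto
  show "strict_mono_on I (\<lambda>\<sigma>. modulus c \<sigma> (\<Lambda> \<sigma>))"
    using \<Lambda> branch_p_strict_mono[OF L] branch_Lambda_point(2)[OF c L] by (intro monotone_onI) auto
  show "smooth_curve_Hper n L I (\<lambda>\<sigma> \<xi>. complex_of_real (phi0 c \<sigma> (\<Lambda> \<sigma>) \<xi>))"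
    using \<Lambda> I by (intro smooth_curve_phi0[OF c L]) (auto simp: open_interval_around_def)
  show "\<forall>\<sigma>\<in>I. fundamental_period (phi0 c \<sigma> (\<Lambda> \<sigma>)) L \<and>
            fundamental_period (psi0 c \<sigma> (\<Lambda> \<sigma>)) L \<and>
            (\<forall>\<xi>. phi0 c \<sigma> (\<Lambda> \<sigma>) field_differentiable (at \<xi>) \<and>
                 deriv (phi0 c \<sigma> (\<Lambda> \<sigma>)) field_differentiable (at \<xi>) \<and>
                 deriv (deriv (phi0 c \<sigma> (\<Lambda> \<sigma>))) \<xi> - \<sigma> * phi0 c \<sigma> (\<Lambda> \<sigma>) \<xi>
                   = psi0 c \<sigma> (\<Lambda> \<sigma>) \<xi> * phi0 c \<sigma> (\<Lambda> \<sigma>) \<xi> \<and>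
                 psi0 c \<sigma> (\<Lambda> \<sigma>) \<xi> = - (1 / (2 * c)) * (phi0 c \<sigma> (\<Lambda> \<sigma>) \<xi>)\<^sup>2)"
  proof
    fix \<sigma> assume "\<sigma> \<in> I"
    note \<sigma> = \<Lambda>[OF this]
    let ?w = "wave_family c L \<sigma>"
    have phi: "phi0 c \<sigma> (\<Lambda> \<sigma>) = ?w"
      using phi0_eq_wave[OF c L \<sigma>(1)] \<sigma>(2) by simp
    have psi: "psi0 c \<sigma> (\<Lambda> \<sigma>) = (\<lambda>\<xi>. - (1 / (2 * c)) * (?w \<xi>)\<^sup>2)"
      using psi0_eq_phi0[OF c] phi by (simp add: fun_eq_iff)
    have "inj_on (\<lambda>y. - (1 / (2 * c)) * y\<^sup>2) {0..}"
      using c by (intro inj_onI) (simp add: power2_eq_iff_nonneg)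
    then show "fundamental_period (phi0 c \<sigma> (\<Lambda> \<sigma>)) L \<and>
            fundamental_period (psi0 c \<sigma> (\<Lambda> \<sigma>)) L \<and>
            (\<forall>\<xi>. phi0 c \<sigma> (\<Lambda> \<sigma>) field_differentiable (at \<xi>) \<and>
                 deriv (phi0 c \<sigma> (\<Lambda> \<sigma>)) field_differentiable (at \<xi>) \<and>
                 deriv (deriv (phi0 c \<sigma> (\<Lambda> \<sigma>))) \<xi> - \<sigma> * phi0 c \<sigma> (\<Lambda> \<sigma>) \<xi>
                   = psi0 c \<sigma> (\<Lambda> \<sigma>) \<xi> * phi0 c \<sigma> (\<Lambda> \<sigma>) \<xi> \<and>
                 psi0 c \<sigma> (\<Lambda> \<sigma>) \<xi> = - (1 / (2 * c)) * (phi0 c \<sigma> (\<Lambda> \<sigma>) \<xi>)\<^sup>2)"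
      unfolding phi psi
      using fundamental_period_wave[OF c L \<sigma>(1)] fundamental_period_wave[OF c L \<sigma>(1), of "\<lambda>y. y"]
        wave_ode[OF c L \<sigma>(1)]
      by auto
  qed
qed

text \<open>Since any branch with positive initial value is identified with
  \<open>branch_Lambda\<close>, no interval has to be shrunk: the maximal range of \<sigma> and the
  whole positive half line already give uniqueness.\<close>

lemma unique_period_branch_Lambda:
  assumes c: "0 < c" and L: "0 < L" and \<sigma>0: "2 * pi\<^sup>2 / L\<^sup>2 < \<sigma>0"
  defines "\<eta>0 \<equiv> branch_Lambda c L \<sigma>0"
  shows "open_interval_around \<sigma>0 {2 * pi\<^sup>2 / L\<^sup>2<..}" "open_interval_around \<eta>0 {0<..}"
    "unique_period_branch L c \<sigma>0 \<eta>0 {2 * pi\<^sup>2 / L\<^sup>2<..} {0<..} (branch_Lambda c L)"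
proof -
  have \<eta>0: "0 < \<eta>0"
    using branch_Lambda_point(5)[OF c L \<sigma>0] by (simp add: \<eta>0_def)
  show I: "open_interval_around \<sigma>0 {2 * pi\<^sup>2 / L\<^sup>2<..}" and "open_interval_around \<eta>0 {0<..}"
    using \<sigma>0 \<eta>0 by (auto simp: open_interval_around_def is_interval_oi)
  show "unique_period_branch L c \<sigma>0 \<eta>0 {2 * pi\<^sup>2 / L\<^sup>2<..} {0<..} (branch_Lambda c L)"
    unfolding unique_period_branch_def
    using period_branch_Lambda[OF c L \<sigma>0] period_branch_eq_Lambda(2)[OF c L \<eta>0 I] by (simp add: \<eta>0_def)
qed

theorem theorem4p1:
  fixes L c \<sigma>0 :: real
  assumes "0 < L" and "0 < c" and "2 * pi\<^sup>2 / L\<^sup>2 < \<sigma>0"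
  shows "(\<exists>!\<eta>0. \<eta>0 \<in> {0<..<sqrt (2 * c * \<sigma>0)} \<and> period_T c \<sigma>0 \<eta>0 = L) \<and>
    (\<forall>\<eta>0. \<eta>0 \<in> {0<..<sqrt (2 * c * \<sigma>0)} \<and> period_T c \<sigma>0 \<eta>0 = L \<longrightarrow>
      (\<exists>I B. open_interval_around \<sigma>0 I \<and> open_interval_around \<eta>0 B \<and>
         (\<exists>\<Lambda>. unique_period_branch L c \<sigma>0 \<eta>0 I B \<Lambda>)) \<and>
      (\<forall>I B \<Lambda>. open_interval_around \<sigma>0 I \<and> open_interval_around \<eta>0 B \<and>
           period_branch L c \<sigma>0 \<eta>0 I B \<Lambda> \<longrightarrow>
         (\<forall>\<sigma>\<in>I.
            fundamental_period (phi0 c \<sigma> (\<Lambda> \<sigma>)) L \<and>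
            fundamental_period (psi0 c \<sigma> (\<Lambda> \<sigma>)) L \<and>
            (\<forall>\<xi>. phi0 c \<sigma> (\<Lambda> \<sigma>) field_differentiable (at \<xi>) \<and>
                 deriv (phi0 c \<sigma> (\<Lambda> \<sigma>)) field_differentiable (at \<xi>) \<and>
                 deriv (deriv (phi0 c \<sigma> (\<Lambda> \<sigma>))) \<xi> - \<sigma> * phi0 c \<sigma> (\<Lambda> \<sigma>) \<xi>
                   = psi0 c \<sigma> (\<Lambda> \<sigma>) \<xi> * phi0 c \<sigma> (\<Lambda> \<sigma>) \<xi> \<and>
                 psi0 c \<sigma> (\<Lambda> \<sigma>) \<xi> = - (1 / (2 * c)) * (phi0 c \<sigma> (\<Lambda> \<sigma>) \<xi>)\<^sup>2)) \<and>
         (\<forall>n\<ge>1. smooth_curve_Hper n L I (\<lambda>\<sigma> \<xi>. complex_of_real (phi0 c \<sigma> (\<Lambda> \<sigma>) \<xi>)))) \<and>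
      (\<exists>B. open_interval_around \<eta>0 B \<and>
         (\<exists>\<Lambda>. unique_period_branch L c \<sigma>0 \<eta>0 {2 * pi\<^sup>2 / L\<^sup>2<..} B \<Lambda>)) \<and>
      (\<forall>I B \<Lambda>. open_interval_around \<sigma>0 I \<and> open_interval_around \<eta>0 B \<and>
           period_branch L c \<sigma>0 \<eta>0 I B \<Lambda> \<longrightarrow>
         strict_antimono_on I \<Lambda> \<and>
         strict_mono_on I (\<lambda>\<sigma>. modulus c \<sigma> (\<Lambda> \<sigma>))))"
proof -
  note L = assms(1) and c = assms(2) and \<sigma>0 = assms(3)
  \<comment> \<open>The bound \<open>\<eta>0 < sqrt (2 c \<sigma>0)\<close> places the squared
    modulus in the unit interval, so the given root is the point of the curve over \<sigma>0 and can
    be replaced by it throughout.\<close>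
  have eq: "\<eta>0 = branch_Lambda c L \<sigma>0"
    if "\<eta>0 \<in> {0<..<sqrt (2 * c * \<sigma>0)} \<and> period_T c \<sigma>0 \<eta>0 = L" for \<eta>0
    using branch_point_unique(2)[OF c L _ modulus_sq_in_unit_interval[OF c]] that
    by (auto simp: branch_Lambda_def)
  have ex1: "\<exists>!\<eta>0. \<eta>0 \<in> {0<..<sqrt (2 * c * \<sigma>0)} \<and> period_T c \<sigma>0 \<eta>0 = L"
    using branch_Lambda_point(4,5)[OF c L \<sigma>0] eq by blast
  have pos: "0 < branch_Lambda c L \<sigma>0"
    using branch_Lambda_point(5)[OF c L \<sigma>0] by simp
  note global = unique_period_branch_Lambda[OF c L \<sigma>0]
  have ex: "\<exists>I B. open_interval_around \<sigma>0 I \<and> open_interval_around (branch_Lambda c L \<sigma>0) B \<and>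
      (\<exists>\<Lambda>. unique_period_branch L c \<sigma>0 (branch_Lambda c L \<sigma>0) I B \<Lambda>)"
    "\<exists>B. open_interval_around (branch_Lambda c L \<sigma>0) B \<and>
      (\<exists>\<Lambda>. unique_period_branch L c \<sigma>0 (branch_Lambda c L \<sigma>0) {2 * pi\<^sup>2 / L\<^sup>2<..} B \<Lambda>)"
    using global by blast+
  show ?thesis
    by (rule conjI[OF ex1], intro allI impI, drule eq, hypsubst, intro conjI allI impI ex;
        elim conjE; rule period_branch_waves[OF c L pos]; assumption)
qed

end
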